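(* Let $n,N\ge 1$ be integers and let $f:\mathbb{D}^{n}\to\mathbb{B}^{N}$ be a pluriharmonic mapping. Then for every $z\in\mathbb{D}^{n}$, $$\max_{\theta\in\mathbb{C}^{n},\ \|\theta\|_{\infty}=1}\left\|Df(z)\theta+\overline{D}f(z)\overline{\theta}\right\|\leq\frac{4}{\pi(1-\|z\|_{\infty}^{2})},$$ where $\theta$ is regarded as a column vector. Moreover, if in addition $f(0)=0$, then for every $z\in\mathbb{D}^{n}$, $$\|f(z)\|\leq\frac{4}{\pi}\arctan\|z\|_{\infty}.$$
   Context: $\mathbb{D}=\{\zeta\in\mathbb{C}:|\zeta|<1\}$, $\mathbb{D}^{n}=\mathbb{D}\times\cdots\times\mathbb{D}$ ($n$ times) is the unit polydisk in $\mathbb{C}^{n}$, and $\mathbb{B}^{N}=\{w\in\mathbb{C}^{N}:\|w\|<1\}$ is the Euclidean unit ball. $\|\cdot\|$ denotes the Euclidean norm, $\|z\|_{\infty}=\max_{1\le j\le n}|z_{j}|$ for $z\in\mathbb{C}^n$, and $\overline{\theta}=(\overline{\theta}_1,\ldots,\overline{\theta}_n)$ is the componentwise conjugate. A continuous complex-valued function $u$ on a domain $\Omega\subset\mathbb{C}^{n}$ is pluriharmonic if for each fixed $z\in\Omega$ and each $\theta\in\mathbb{C}^n$ with $\|\theta\|=1$, the function $\zeta\mapsto u(z+\theta\zeta)$ is harmonic in $\{\zeta\in\mathbb{C}:|\zeta|<d_{\Omega}(z)\}$, where $d_{\Omega}(z)$ is the Euclidean distance from $z$ to $\partial\Omega$.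 On a simply connected domain $\Omega$ this is equivalent to $u=h+\overline{g}$ with $h,g$ holomorphic in $\Omega$. A mapping $f=(f_1,\ldots,f_N)$ into $\mathbb{C}^N$ is pluriharmonic if each component $f_j$ is pluriharmonic. For such $f$, $Df=\left(\partial f_{j}/\partial z_{m}\right)_{1\le j\le N,\,1\le m\le n}$ and $\overline{D}f=\left(\partial f_{j}/\partial\overline{z}_{m}\right)_{1\le j\le N,\,1\le m\le n}$ are the two $N\times n$ matrices of Wirtinger derivatives. *)

theory Defs
  imports "HOL-Analysis.Analysis"
begin

text \<open>
  Points of \<open>\<complex>\<^sup>n\<close> are vectors of type \<^typ>\<open>complex ^ 'n\<close>, whose library norm is the Euclidean one.
  The library constant \<^const>\<open>infnorm\<close> is the maximum over the \<open>2n\<close> real coordinates, not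
  the maximum of the moduli of the complex coordinates, so it cannot be used for the sup norm here.
\<close>

definition sup_norm :: "complex ^ 'n \<Rightarrow> real" where
  "sup_norm z = Max (range (\<lambda>j. cmod (z $ j)))"

definition polydisk :: "(complex ^ 'n) set" where
  "polydisk = {z. \<forall>j. cmod (z $ j) < 1}"

definition cnj_vec :: "complex ^ 'n \<Rightarrow> complex ^ 'n" where
  "cnj_vec \<theta> = (\<chi> m. cnj (\<theta> $ m))"

text \<open>
  A complex-valued function on an open set is harmonic if it is twice continuously (real)
  differentiable with vanishing Laplacian. Here \<open>ux\<close>, \<open>uy\<close> are the first-order
  and \<open>uxx\<close>, \<open>uxy\<close>, \<open>uyx\<close>, \<open>uyy\<close> the second-order
  partial derivatives with respect to the real and imaginary parts of the variable.
\<close>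

definition harmonic_on :: "complex set \<Rightarrow> (complex \<Rightarrow> complex) \<Rightarrow> bool" where
  "harmonic_on S u \<longleftrightarrow>
     (\<exists>ux uy uxx uxy uyx uyy.
        (\<forall>\<zeta>\<in>S. (u has_derivative (\<lambda>h. Re h *\<^sub>R ux \<zeta> + Im h *\<^sub>R uy \<zeta>)) (at \<zeta>)) \<and>
        (\<forall>\<zeta>\<in>S. (ux has_derivative (\<lambda>h. Re h *\<^sub>R uxx \<zeta> + Im h *\<^sub>R uxy \<zeta>)) (at \<zeta>)) \<and>
        (\<forall>\<zeta>\<in>S. (uy has_derivative (\<lambda>h. Re h *\<^sub>R uyx \<zeta> + Im h *\<^sub>R uyy \<zeta>)) (at \<zeta>)) \<and>
        continuous_on S uxx \<and> continuous_on S uxy \<and>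
        continuous_on S uyx \<and> continuous_on S uyy \<and>
        (\<forall>\<zeta>\<in>S. uxx \<zeta> + uyy \<zeta> = 0))"

text \<open>
  \<open>\<Omega>\<close> is meant to be a domain. The distance to the boundary is infinite when
  \<open>\<Omega>\<close> is the whole space, whereas \<^const>\<open>infdist\<close> to the empty frontier
  is \<open>0\<close>; hence the separate disjunct.
\<close>

definition pluriharmonic_on :: "(complex ^ 'n) set \<Rightarrow> (complex ^ 'n \<Rightarrow> complex) \<Rightarrow> bool" where
  "pluriharmonic_on \<Omega> u \<longleftrightarrow>
     continuous_on \<Omega> u \<and>
     (\<forall>z\<in>\<Omega>. \<forall>\<theta>. norm \<theta> = 1 \<longrightarrow>
        harmonic_on {\<zeta>. \<Omega> = UNIV \<or> cmod \<zeta> < infdist z (frontier \<Omega>)} (\<lambda>\<zeta>. u (z + \<zeta> *s \<theta>)))"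

definition pluriharmonic_map_on ::
    "(complex ^ 'n) set \<Rightarrow> (complex ^ 'n \<Rightarrow> complex ^ 'N) \<Rightarrow> bool" where
  "pluriharmonic_map_on \<Omega> f \<longleftrightarrow> (\<forall>j. pluriharmonic_on \<Omega> (\<lambda>z. f z $ j))"

text \<open>Partial derivatives with respect to \<open>x\<^sub>m\<close> and \<open>y\<^sub>m\<close>, where \<open>z\<^sub>m = x\<^sub>m + \<i> y\<^sub>m\<close>.\<close>

definition partial_x :: "'n \<Rightarrow> (complex ^ 'n \<Rightarrow> complex) \<Rightarrow> complex ^ 'n \<Rightarrow> complex" where
  "partial_x m u z = vector_derivative (\<lambda>t. u (z + axis m (of_real t))) (at 0)"

definition partial_y :: "'n \<Rightarrow> (complex ^ 'n \<Rightarrow> complex) \<Rightarrow> complex ^ 'n \<Rightarrow> complex" where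
  "partial_y m u z = vector_derivative (\<lambda>t. u (z + axis m (\<i> * of_real t))) (at 0)"

definition wirtinger :: "'n \<Rightarrow> (complex ^ 'n \<Rightarrow> complex) \<Rightarrow> complex ^ 'n \<Rightarrow> complex" where
  "wirtinger m u z = (partial_x m u z - \<i> * partial_y m u z) / 2"

definition wirtinger_bar :: "'n \<Rightarrow> (complex ^ 'n \<Rightarrow> complex) \<Rightarrow> complex ^ 'n \<Rightarrow> complex" where
  "wirtinger_bar m u z = (partial_x m u z + \<i> * partial_y m u z) / 2"

definition D_mat :: "(complex ^ 'n \<Rightarrow> complex ^ 'N) \<Rightarrow> complex ^ 'n \<Rightarrow> complex ^ 'n ^ 'N" where
  "D_mat f z = (\<chi> j m. wirtinger m (\<lambda>w. f w $ j) z)"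

definition Dbar_mat :: "(complex ^ 'n \<Rightarrow> complex ^ 'N) \<Rightarrow> complex ^ 'n \<Rightarrow> complex ^ 'n ^ 'N" where
  "Dbar_mat f z = (\<chi> j m. wirtinger_bar m (\<lambda>w. f w $ j) z)"

text \<open>
  \<open>is_maximum_on F S M\<close>: the maximum of \<open>F\<close> over the (possibly infinite) set
  \<open>S\<close> is attained and equals \<open>M\<close>.
\<close>

definition is_maximum_on :: "('a \<Rightarrow> real) \<Rightarrow> 'a set \<Rightarrow> real \<Rightarrow> bool" where
  "is_maximum_on F S M \<longleftrightarrow> M \<in> F ` S \<and> (\<forall>x\<in>S. F x \<le> M)"

end

theory Submission
  imports Defs "HOL-Complex_Analysis.Complex_Analysis"
begin

text \<open>
  Both estimates reduce to one real-valued function of one complex variable. Fix a vector \<open>w\<close>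
  with norm at most one. The function \<open>u z = f z \<bullet> w\<close> is real pluriharmonic and
  \<open>\<bar>u\<bar> < 1\<close>. If \<open>\<phi>\<close> is a holomorphic map of the unit disk into the polydisk, then
  \<open>u \<circ> \<phi>\<close> is harmonic on the disk, hence the real part of a holomorphic \<open>F\<close> with values in
  the strip \<open>\<bar>Re\<bar> < 1\<close>. The map \<open>tan (\<pi>/4 \<cdot> _)\<close> sends that strip into the unit disk, so the
  Schwarz lemma yields \<open>\<bar>Re F \<zeta>\<bar> \<le> 4/\<pi> \<cdot> arctan \<bar>\<zeta>\<bar>\<close> whenever \<open>Re F 0 = 0\<close>
  (\<open>harmonic_Schwarz\<close>); applied to the odd part of \<open>F\<close> it bounds the derivative at the
  origin by \<open>4/\<pi>\<close> with no condition on \<open>F 0\<close> (\<open>harmonic_gradient_bound\<close>).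

  The growth estimate follows from the disk \<open>\<zeta> \<mapsto> \<zeta> z / \<parallel>z\<parallel>\<close> (sup norm) and \<open>w\<close> in the
  direction of \<open>f z\<close>. For the gradient estimate \<open>w\<close> points in the direction of
  \<open>Df \<theta> + \<dots>\<close>, and \<open>\<phi>\<close> is a Moebius transformation in each coordinate with
  \<open>\<phi> 0 = z\<close> and \<open>\<phi>' 0 = (1 - \<parallel>z\<parallel>\<^sup>2) \<theta>\<close>; such a disk exists because
  \<open>1 - \<parallel>z\<parallel>\<^sup>2 \<le> 1 - \<bar>z\<^sub>j\<bar>\<^sup>2\<close> for every \<open>j\<close>. It is curved, so
  harmonicity along complex lines does not apply to it directly.

  The substance of the proof is therefore regularity: a continuous function that is harmonic on
  complex lines stays harmonic along holomorphic disks (\<open>real_pluriharmonic_compose_holomorphic\<close>).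
  On a line, \<open>u\<close> is the real part of a holomorphic function, whose derivative is an average of
  \<open>u\<close> over a circle (\<open>deriv_eq_circle_average\<close>). Averages of a continuous function depend
  continuously on the centre, so the partial derivatives of \<open>u\<close> are continuous and \<open>u\<close> is
  differentiable; differentiating under the average shows that the partial derivatives are
  differentiable in turn. Harmonicity along \<^emph>\<open>all\<close> lines says that a sesquilinear form, the
  complex Hessian, vanishes on the diagonal; it therefore vanishes
  (\<open>sesquilinear_diagonal_zero\<close>), which makes the Wirtinger derivatives
  \<open>\<partial>u/\<partial>z\<^sub>m\<close> holomorphic. The chain rule then gives a holomorphic derivative of
  \<open>u \<circ> \<phi>\<close>, and a primitive of it is \<open>F\<close>.
\<close>

section \<open>Harmonic functions of one variable as real parts of holomorphic functions\<close>

text \<open>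
  The mean value theorem in the first coordinate turns the second difference into a difference of
  \<open>a = \<partial>u/\<partial>x\<close> in the second coordinate, which differentiability of \<open>a\<close> at the point evaluates.
  The quotient is symmetric in the two coordinates, so it can serve both mixed derivatives.
\<close>
lemma mixed_difference_quotient:
  fixes u a b :: "complex \<Rightarrow> real"
  assumes r: "r > 0"
    and du: "\<And>\<zeta>. \<zeta> \<in> ball z r \<Longrightarrow> (u has_derivative (\<lambda>h. Re h * a \<zeta> + Im h * b \<zeta>)) (at \<zeta>)"
    and da: "(a has_derivative (\<lambda>h. Re h * ax + Im h * ay)) (at z)"
  shows "((\<lambda>t. (u (z + Complex t t) - u (z + Complex t 0) - u (z + Complex 0 t) + u z) / t\<^sup>2) \<longlongrightarrow> ay) (at_right 0)"
proof (rule tendstoI)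
  fix e :: real assume e: "e > 0"
  \<comment> \<open>Below \<open>a\<close> is evaluated at distances at most \<open>2 t\<close> and \<open>t\<close> from \<open>z\<close>, with total error \<open>3 \<epsilon> t\<close>.\<close>
  define \<epsilon> where "\<epsilon> = e / 4"
  have \<epsilon>: "\<epsilon> > 0" using e by (simp add: \<epsilon>_def)
  obtain d where d: "d > 0"
    and d1: "\<And>w. norm (w - z) < d \<Longrightarrow> \<bar>a w - a z - (Re (w - z) * ax + Im (w - z) * ay)\<bar> \<le> \<epsilon> * norm (w - z)"
    using da \<epsilon> unfolding has_derivative_within_alt by (auto simp: dist_norm)
  define \<delta> where "\<delta> = min d r / 2"
  have \<delta>: "\<delta> > 0" using d r by (simp add: \<delta>_def)
  have main: "\<bar>(u (z + Complex t t) - u (z + Complex t 0) - u (z + Complex 0 t) + u z) / t\<^sup>2 - ay\<bar> < e"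
    if t: "0 < t" "t < \<delta>" for t
  proof -
    define \<psi> where "\<psi> = (\<lambda>x. u (z + Complex x t) - u (z + Complex x 0))"
    have small: "norm (Complex x y) < 2 * \<delta>" if "0 \<le> x" "x \<le> t" "0 \<le> y" "y \<le> t" for x y
      using cmod_le[of "Complex x y"] that t by simp
    have inb: "z + Complex x y \<in> ball z r" if "0 \<le> x" "x \<le> t" "0 \<le> y" "y \<le> t" for x y
      using small[OF that] by (simp add: dist_norm \<delta>_def)
    have der: "((\<lambda>x. u (z + Complex x y)) has_real_derivative a (z + Complex x y)) (at x)"
      if "0 \<le> x" "x \<le> t" "0 \<le> y" "y \<le> t" for x y
    proof -
      have 1: "((\<lambda>x. z + Complex x y) has_derivative (\<lambda>h. of_real h)) (at x)"
        unfolding Complex_eq by (auto intro!: derivative_eq_intros)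
      from has_derivative_compose[OF 1 du[OF inb[OF that]]]
      show ?thesis
        by (simp add: has_field_derivative_def mult_commute_abs)
    qed
    have "\<exists>x::real. x > 0 \<and> x < t \<and> \<psi> t - \<psi> 0 = (t - 0) * (a (z + Complex x t) - a (z + Complex x 0))"
      unfolding \<psi>_def using t by (intro MVT2) (auto intro!: derivative_intros der)
    then obtain x where x: "0 < x" "x < t"
      and eq: "\<psi> t - \<psi> 0 = t * (a (z + Complex x t) - a (z + Complex x 0))" by auto
    have n: "norm (Complex x t) \<le> 2 * t" "norm (Complex x 0) \<le> t"
      using cmod_le[of "Complex x t"] cmod_le[of "Complex x 0"] x t by auto
    have A: "\<bar>a (z + Complex x t) - a z - (x * ax + t * ay)\<bar> \<le> \<epsilon> * (2 * t)"
      using d1[of "z + Complex x t"] small[of x t] x t n \<epsilon>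
      by (force simp: \<delta>_def intro: order_trans mult_left_mono)
    have B: "\<bar>a (z + Complex x 0) - a z - (x * ax)\<bar> \<le> \<epsilon> * t"
      using d1[of "z + Complex x 0"] small[of x 0] x t n \<epsilon>
      by (force simp: \<delta>_def intro: order_trans mult_left_mono)
    have C: "\<bar>a (z + Complex x t) - a (z + Complex x 0) - t * ay\<bar> \<le> 3 * \<epsilon> * t"
      using A B by linarith
    have D: "(u (z + Complex t t) - u (z + Complex t 0) - u (z + Complex 0 t) + u z)
         = t * (a (z + Complex x t) - a (z + Complex x 0))"
      using eq Complex_eq_0 by (simp add: \<psi>_def zero_complex.code[symmetric])
    have "(u (z + Complex t t) - u (z + Complex t 0) - u (z + Complex 0 t) + u z) / t\<^sup>2 - ay
        = (a (z + Complex x t) - a (z + Complex x 0) - t * ay) / t"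
    proof -
      have "t * A / t\<^sup>2 - ay = (A - t * ay) / t" for A
        using t by (simp add: field_simps power2_eq_square)
      then show ?thesis unfolding D .
    qed
    also have "\<bar>\<dots>\<bar> \<le> 3 * \<epsilon>"
      using C t by (simp add: abs_divide divide_le_eq)
    finally show ?thesis using e by (simp add: \<epsilon>_def)
  qed
  show "\<forall>\<^sub>F t in at_right 0. dist ((u (z + Complex t t) - u (z + Complex t 0) - u (z + Complex 0 t) + u z) / t\<^sup>2) ay < e"
    unfolding eventually_at_right_field dist_real_def using main \<delta> by auto
qed

text \<open>
  Exchanging the two coordinates leaves the second difference unchanged and exchanges the roles of
  \<open>a\<close> and \<open>b\<close>, so both mixed derivatives are the limit of the same quotient.
\<close>
lemma mixed_partials_eq:
  fixes u a b :: "complex \<Rightarrow> real"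
  assumes r: "r > 0"
    and du: "\<And>\<zeta>. \<zeta> \<in> ball z r \<Longrightarrow> (u has_derivative (\<lambda>h. Re h * a \<zeta> + Im h * b \<zeta>)) (at \<zeta>)"
    and da: "(a has_derivative (\<lambda>h. Re h * ax + Im h * ay)) (at z)"
    and db: "(b has_derivative (\<lambda>h. Re h * bx + Im h * by)) (at z)"
  shows "ay = bx"
proof -
  \<comment> \<open>Reflection in the diagonal, which exchanges real and imaginary part.\<close>
  define sw where "sw = (\<lambda>\<zeta>. \<i> * cnj \<zeta>)"
  have sw_Re: "Re (sw \<zeta>) = Im \<zeta>" "Im (sw \<zeta>) = Re \<zeta>" for \<zeta> by (auto simp: sw_def)
  have sw_sw: "sw (sw \<zeta>) = \<zeta>" for \<zeta> by (simp add: sw_def)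
  have sw_add: "sw (\<zeta> + \<xi>) = sw \<zeta> + sw \<xi>" for \<zeta> \<xi> by (simp add: sw_def algebra_simps)
  have sw_der: "(sw has_derivative sw) (at \<zeta>)" for \<zeta>
    unfolding sw_def by (auto intro!: derivative_eq_intros)
  have swc: "sw (Complex x y) = Complex y x" for x y by (simp add: sw_def complex_eq_iff)
  have 1: "((\<lambda>t. (u (z + Complex t t) - u (z + Complex t 0) - u (z + Complex 0 t) + u z) / t\<^sup>2) \<longlongrightarrow> ay) (at_right 0)"
    by (rule mixed_difference_quotient[OF r du da])
  have dist: "dist (sw x) (sw y) = dist x y" for x y
  proof -
    have "sw x - sw y = \<i> * cnj (x - y)" by (simp add: sw_def algebra_simps)
    then show ?thesis by (simp add: dist_norm norm_mult del: complex_cnj_diff)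
  qed
  have du': "((\<lambda>\<zeta>. u (sw \<zeta>)) has_derivative (\<lambda>h. Re h * b (sw \<zeta>) + Im h * a (sw \<zeta>))) (at \<zeta>)"
    if "\<zeta> \<in> ball (sw z) r" for \<zeta>
  proof -
    have "sw \<zeta> \<in> ball z r" using that dist[of "sw z" \<zeta>] by (simp add: sw_sw)
    from has_derivative_compose[OF sw_der du[OF this]] show ?thesis
      by (simp add: sw_Re add.commute)
  qed
  have db': "((\<lambda>\<zeta>. b (sw \<zeta>)) has_derivative (\<lambda>h. Re h * by + Im h * bx)) (at (sw z))"
    using has_derivative_compose[OF sw_der[of "sw z"], of b "\<lambda>h. Re h * bx + Im h * by"] db
    by (simp add: sw_sw sw_Re add.commute)
  have eq: "u (sw (sw z + Complex x y)) = u (z + Complex y x)" for x y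
    by (simp only: sw_add sw_sw swc)
  have 2: "((\<lambda>t. (u (z + Complex t t) - u (z + Complex t 0) - u (z + Complex 0 t) + u z) / t\<^sup>2) \<longlongrightarrow> bx) (at_right 0)"
    using mixed_difference_quotient[OF r du' db'] unfolding eq sw_sw
    by (rule back_subst[where P = "\<lambda>f. filterlim f _ _"]) (auto simp: fun_eq_iff)
  show ?thesis by (rule tendsto_unique[OF _ 1 2]) simp
qed

text \<open>
  On a convex open set \<open>p\<close> has a primitive, whose real part has the same real derivative as
  \<open>v\<close> and so differs from it by a constant.
\<close>
lemma has_derivative_Re_imp_eq:
  assumes "convex S" "open S"
    and v: "\<And>\<zeta>. \<zeta> \<in> S \<Longrightarrow> (v has_derivative (\<lambda>h. Re (p \<zeta> * h))) (at \<zeta>)"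
    and p: "p holomorphic_on S"
  shows "\<exists>F. F holomorphic_on S \<and> (\<forall>\<zeta>\<in>S. v \<zeta> = Re (F \<zeta>) \<and> (F has_field_derivative p \<zeta>) (at \<zeta>))"
proof -
  obtain F where F: "\<And>\<zeta>. \<zeta> \<in> S \<Longrightarrow> (F has_field_derivative p \<zeta>) (at \<zeta>)"
    using holomorphic_convex_primitive'[OF assms(1,2) p] assms(2) by (metis at_within_open)
  have "((\<lambda>\<zeta>. v \<zeta> - Re (F \<zeta>)) has_derivative (\<lambda>h. 0)) (at \<zeta> within S)" if "\<zeta> \<in> S" for \<zeta>
  proof -
    have "((\<lambda>\<zeta>. Re (F \<zeta>)) has_derivative (\<lambda>h. Re (p \<zeta> * h))) (at \<zeta>)"
      using F[OF that] unfolding has_field_derivative_def by (rule has_derivative_Re)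
    from has_derivative_diff[OF v[OF that] this] show ?thesis
      by (simp add: has_derivative_at_withinI)
  qed
  then obtain c where c: "\<And>\<zeta>. \<zeta> \<in> S \<Longrightarrow> v \<zeta> - Re (F \<zeta>) = c"
    using has_derivative_zero_constant[OF assms(1), of "\<lambda>\<zeta>. v \<zeta> - Re (F \<zeta>)"] by auto
  show ?thesis
  proof (intro exI conjI ballI)
    fix \<zeta> assume z: "\<zeta> \<in> S"
    show "v \<zeta> = Re (F \<zeta> + of_real c)" using c[OF z] by simp
    show "((\<lambda>\<zeta>. F \<zeta> + of_real c) has_field_derivative p \<zeta>) (at \<zeta>)"
      using F[OF z] by (auto intro!: derivative_eq_intros)
  next
    show "(\<lambda>\<zeta>. F \<zeta> + of_real c) holomorphic_on S"
      using F assms(2) by (intro holomorphic_intros) (auto simp: holomorphic_on_open)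
  qed
qed

text \<open>
  For \<open>v = k \<bullet> c\<close> the function \<open>p = v\<^sub>x - \<i> v\<^sub>y\<close> satisfies the Cauchy-Riemann equations: one of
  them is the vanishing of the Laplacian, the other the symmetry of the mixed derivatives.
\<close>
lemma harmonic_on_inner_eq_Re_holomorphic:
  assumes "harmonic_on S k" "open S" "convex S"
  shows "\<exists>F. F holomorphic_on S \<and> (\<forall>\<zeta>\<in>S. k \<zeta> \<bullet> c = Re (F \<zeta>))"
proof -
  obtain ux uy uxx uxy uyx uyy where
    du: "\<And>\<zeta>. \<zeta> \<in> S \<Longrightarrow> (k has_derivative (\<lambda>h. Re h *\<^sub>R ux \<zeta> + Im h *\<^sub>R uy \<zeta>)) (at \<zeta>)" and
    dux: "\<And>\<zeta>. \<zeta> \<in> S \<Longrightarrow> (ux has_derivative (\<lambda>h. Re h *\<^sub>R uxx \<zeta> + Im h *\<^sub>R uxy \<zeta>)) (at \<zeta>)" and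
    duy: "\<And>\<zeta>. \<zeta> \<in> S \<Longrightarrow> (uy has_derivative (\<lambda>h. Re h *\<^sub>R uyx \<zeta> + Im h *\<^sub>R uyy \<zeta>)) (at \<zeta>)" and
    lap: "\<And>\<zeta>. \<zeta> \<in> S \<Longrightarrow> uxx \<zeta> + uyy \<zeta> = 0"
    using assms(1) unfolding harmonic_on_def by blast
  have inner: "((\<lambda>\<zeta>. g \<zeta> \<bullet> c) has_derivative (\<lambda>h. Re h * (gx \<bullet> c) + Im h * (gy \<bullet> c))) (at \<zeta>)"
    if "(g has_derivative (\<lambda>h. Re h *\<^sub>R gx + Im h *\<^sub>R gy)) (at \<zeta>)" for g gx gy \<zeta>
    using has_derivative_inner_left[OF that, of c] by (simp add: inner_left_distrib)
  define p where "p = (\<lambda>\<zeta>. Complex (ux \<zeta> \<bullet> c) (- (uy \<zeta> \<bullet> c)))"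
  have "(p has_field_derivative Complex (uxx \<zeta> \<bullet> c) (- (uyx \<zeta> \<bullet> c))) (at \<zeta>)" if z: "\<zeta> \<in> S" for \<zeta>
  proof -
    obtain r where r: "r > 0" "ball \<zeta> r \<subseteq> S" using assms(2) z open_contains_ball by blast
    have mix: "uxy \<zeta> \<bullet> c = uyx \<zeta> \<bullet> c"
      by (rule mixed_partials_eq[OF r(1) inner[OF du] inner[OF dux[OF z]] inner[OF duy[OF z]]]) (use r in auto)
    have "uyy \<zeta> = - uxx \<zeta>" using lap[OF z] by (simp add: eq_neg_iff_add_eq_0 add.commute)
    then have lap': "uyy \<zeta> \<bullet> c = - (uxx \<zeta> \<bullet> c)" by simp
    have "(p has_derivative (\<lambda>h. Complex (Re h * (uxx \<zeta> \<bullet> c) + Im h * (uxy \<zeta> \<bullet> c)) (- (Re h * (uyx \<zeta> \<bullet> c) + Im h * (uyy \<zeta> \<bullet> c))))) (at \<zeta>)"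
      unfolding p_def Complex_eq
      by (intro derivative_intros inner[OF dux[OF z]] inner[OF duy[OF z]])
    also have "(\<lambda>h. Complex (Re h * (uxx \<zeta> \<bullet> c) + Im h * (uxy \<zeta> \<bullet> c)) (- (Re h * (uyx \<zeta> \<bullet> c) + Im h * (uyy \<zeta> \<bullet> c))))
       = (*) (Complex (uxx \<zeta> \<bullet> c) (- (uyx \<zeta> \<bullet> c)))"
      unfolding mix lap' by (auto simp: fun_eq_iff complex_eq_iff algebra_simps)
    finally show ?thesis by (simp add: has_field_derivative_def)
  qed
  then have "p holomorphic_on S"
    using assms(2) by (auto simp: holomorphic_on_open)
  moreover have "((\<lambda>\<zeta>. k \<zeta> \<bullet> c) has_derivative (\<lambda>h. Re (p \<zeta> * h))) (at \<zeta>)" if "\<zeta> \<in> S" for \<zeta>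
    using inner[OF du[OF that]] by (simp add: p_def algebra_simps)
  ultimately show ?thesis
    using has_derivative_Re_imp_eq[OF assms(3,2)] by metis
qed

section \<open>Continuity of the complex gradient of a pluriharmonic function\<close>

text \<open>
  Harmonicity on lines is recorded as being the real part of a holomorphic function, and the radius
  is that of any ball inside \<open>\<Omega>\<close>: for all centres near a given point the same circle can
  then be used, which is what makes circle averages depend continuously on the centre.
\<close>
definition real_pluriharmonic_on :: "(complex ^ 'n) set \<Rightarrow> (complex ^ 'n \<Rightarrow> real) \<Rightarrow> bool" where
  "real_pluriharmonic_on \<Omega> u \<longleftrightarrow> continuous_on \<Omega> u \<and>
     (\<forall>z \<rho> \<theta>. ball z \<rho> \<subseteq> \<Omega> \<longrightarrow> norm \<theta> = 1 \<longrightarrow>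
        (\<exists>F. F holomorphic_on ball 0 \<rho> \<and> (\<forall>\<zeta>\<in>ball 0 \<rho>. u (z + \<zeta> *s \<theta>) = Re (F \<zeta>))))"

text \<open>
  Twice the Wirtinger derivative \<open>\<partial>u/\<partial>z\<^sub>m\<close>: for differentiable real \<open>u\<close> the differential along
  the \<open>m\<close>-th complex axis has the form \<open>h \<mapsto> Re (a h)\<close> for a unique \<open>a\<close>.
\<close>
definition cgrad :: "(complex ^ 'n \<Rightarrow> real) \<Rightarrow> complex ^ 'n \<Rightarrow> 'n \<Rightarrow> complex" where
  "cgrad u z m = (THE a. ((\<lambda>\<zeta>. u (z + \<zeta> *s axis m 1)) has_derivative (\<lambda>h. Re (a * h))) (at 0))"

lemma Re_mult_eq_imp_eq:
  assumes "(\<lambda>h. Re (a * h)) = (\<lambda>h. Re (b * h))"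
  shows "a = b"
  using fun_cong[OF assms, of 1] fun_cong[OF assms, of \<i>] by (simp add: complex_eq_iff)

lemma cgrad_eqI:
  assumes "((\<lambda>\<zeta>. u (z + \<zeta> *s axis m 1)) has_derivative (\<lambda>h. Re (a * h))) (at 0)"
  shows "cgrad u z m = a"
  unfolding cgrad_def using assms
  by (rule the_equality) (rule Re_mult_eq_imp_eq, rule has_derivative_unique[OF _ assms])

text \<open>
  Cauchy's formula gives the derivative as an average of \<open>F\<close> against the conjugate of
  \<open>cis\<close>. The conjugate of \<open>F\<close> has average zero against it, by Cauchy's theorem
  for \<open>F\<close> itself, so it may be added; this replaces \<open>F\<close> by twice its real part.
\<close>
lemma deriv_eq_circle_average:
  fixes F :: "complex \<Rightarrow> complex" and s :: real
  assumes F: "F holomorphic_on ball 0 R" and s: "0 < s" "s < R"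
  shows "deriv F 0 = 2 / s * integral (cbox 0 1) (\<lambda>t. Re (F (s * cis (2 * pi * t))) * cnj (cis (2 * pi * t)))"
proof -
  define E where "E = (\<lambda>t::real. cis (2 * pi * t))"
  have E: "exp (2 * of_real pi * \<i> * of_real t) = E t" for t
    by (simp add: E_def cis_conv_exp mult_ac)
  have vd: "vector_derivative (circlepath 0 s) (at t within {0..1}) = 2 * pi * \<i> * s * E t" if "0 \<le> t" "t \<le> 1" for t
    using vector_derivative_circlepath01[OF that, of 0 s] by (simp only: E)
  have cp: "circlepath 0 s t = s * E t" for t by (simp add: circlepath E)
  have Ene: "E t \<noteq> 0" "1 / E t = cnj (E t)" for t by (auto simp: E_def cis_cnj divide_inverse cis_inverse)
  have cont: "continuous_on (cball 0 s) F" and hol: "F holomorphic_on ball 0 s"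
    using F s by (auto intro!: holomorphic_on_imp_continuous_on holomorphic_on_subset[OF F])
  have in0: "0 \<in> ball (0::complex) s" using s by simp
  have "((\<lambda>u. F u / (u - 0)\<^sup>2) has_contour_integral (2 * of_real pi * \<i>) * deriv F 0) (circlepath 0 s)"
    using Cauchy_derivative_integral_circlepath[OF cont hol in0]
    by (auto dest!: DERIV_imp_deriv intro: has_contour_integral_integral)
  then have "((\<lambda>t. F (s * E t) / (s * E t)\<^sup>2 * (2 * pi * \<i> * s * E t)) has_integral (2 * of_real pi * \<i>) * deriv F 0) {0..1}"
    unfolding has_contour_integral_def
    by (rule has_integral_cong[THEN iffD1, rotated])
       (simp add: vd cp)
  from has_integral_mult_right[OF this, of "s / (2 * pi * \<i>)"]
  have "((\<lambda>t. s / (2 * pi * \<i>) * (F (s * E t) / (s * E t)\<^sup>2 * (2 * pi * \<i> * s * E t))) has_integral s * deriv F 0) {0..1}"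
    by (rule has_integral_eq_rhs) (simp add: complex_eq_iff)
  also have "(\<lambda>t. s / (2 * pi * \<i>) * (F (s * E t) / (s * E t)\<^sup>2 * (2 * pi * \<i> * s * E t))) = (\<lambda>t. F (s * E t) * (1 / E t))"
    using s Ene(1) by (intro ext) (simp add: field_simps power2_eq_square)
  finally have 1: "((\<lambda>t. F (s * E t) * cnj (E t)) has_integral s * deriv F 0) {0..1}"
    by (simp add: Ene)
  have "(F has_contour_integral 0) (circlepath 0 s)"
    by (rule Cauchy_theorem_disc_simple[OF F]) (use s in auto)
  then have "((\<lambda>t. F (s * E t) * (2 * pi * \<i> * s * E t)) has_integral 0) {0..1}"
    unfolding has_contour_integral_def
    by (rule has_integral_cong[THEN iffD1, rotated])
       (simp add: vd cp)
  from has_integral_mult_right[OF this, of "1 / (2 * pi * \<i> * s)"]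
  have "((\<lambda>t. F (s * E t) * E t) has_integral 0) {0..1}"
    using s by simp
  from has_integral_linear[OF this bounded_linear_cnj]
  have 2: "((\<lambda>t. cnj (F (s * E t)) * cnj (E t)) has_integral 0) {0..1}"
    by (simp add: o_def)
  have "((\<lambda>t. 2 * (Re (F (s * E t)) * cnj (E t))) has_integral s * deriv F 0) {0..1}"
    using has_integral_add[OF 1 2] by (simp add: complex_add_cnj ring_distribs(2)[symmetric] mult.assoc)
  from has_integral_mult_right[OF this, of "1 / 2"]
  have "integral {0..1} (\<lambda>t. Re (F (s * E t)) * cnj (E t)) = s * deriv F 0 / 2"
    by (intro integral_unique) simp
  then show ?thesis using s by (simp add: E_def field_simps)
qed

lemma holomorphic_imp_Re_has_derivative:
  assumes "F holomorphic_on S" "open S" "\<And>\<zeta>. \<zeta> \<in> S \<Longrightarrow> v \<zeta> = Re (F \<zeta>)" "\<zeta> \<in> S"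
  shows "(v has_derivative (\<lambda>h. Re (deriv F \<zeta> * h))) (at \<zeta>)"
proof -
  have "(F has_field_derivative deriv F \<zeta>) (at \<zeta>)"
    by (rule holomorphic_derivI[OF assms(1,2,4)])
  then have "((\<lambda>\<zeta>. Re (F \<zeta>)) has_derivative (\<lambda>h. Re (deriv F \<zeta> * h))) (at \<zeta>)"
    unfolding has_field_derivative_def by (rule has_derivative_Re)
  then show ?thesis
    by (rule has_derivative_transform_within_open[OF _ assms(2,4)]) (simp add: assms(3))
qed

lemma norm_vector_smult: "norm (c *s v) = norm c * norm (v :: complex ^ 'n)"
  by (simp add: norm_vec_def norm_mult L2_set_right_distrib)

lemma cgrad_circle_average:
  fixes s :: real
  assumes u: "real_pluriharmonic_on \<Omega> u" and "ball z \<rho> \<subseteq> \<Omega>" "0 < s" "s < \<rho>"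
  shows "((\<lambda>\<zeta>. u (z + \<zeta> *s axis m 1)) has_derivative (\<lambda>h. Re (cgrad u z m * h))) (at 0)"
    and "cgrad u z m = 2 / s * integral (cbox 0 1)
           (\<lambda>t. u (z + (s * cis (2 * pi * t)) *s axis m 1) * cnj (cis (2 * pi * t)))"
proof -
  have "norm (axis m (1::complex)) = 1" by simp
  then obtain F where F: "F holomorphic_on ball 0 \<rho>"
    "\<And>\<zeta>. \<zeta> \<in> ball 0 \<rho> \<Longrightarrow> u (z + \<zeta> *s axis m 1) = Re (F \<zeta>)"
    using u assms(2) unfolding real_pluriharmonic_on_def by blast
  have d: "((\<lambda>\<zeta>. u (z + \<zeta> *s axis m 1)) has_derivative (\<lambda>h. Re (deriv F 0 * h))) (at 0)"
    by (rule holomorphic_imp_Re_has_derivative[OF F(1) open_ball]) (use F assms in auto)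
  then have c: "cgrad u z m = deriv F 0" by (rule cgrad_eqI)
  show "((\<lambda>\<zeta>. u (z + \<zeta> *s axis m 1)) has_derivative (\<lambda>h. Re (cgrad u z m * h))) (at 0)"
    using d c by simp
  have "u (z + (s * cis (2 * pi * t)) *s axis m 1) = Re (F (s * cis (2 * pi * t)))" for t
    by (rule F(2)) (use assms in \<open>simp add: norm_mult\<close>)
  then show "cgrad u z m = 2 / s * integral (cbox 0 1)
           (\<lambda>t. u (z + (s * cis (2 * pi * t)) *s axis m 1) * cnj (cis (2 * pi * t)))"
    unfolding c deriv_eq_circle_average[OF F(1) assms(3,4)] by simp
qed

lemma open_uniform_ball:
  fixes z :: "'a::metric_space"
  assumes "open \<Omega>" "z \<in> \<Omega>"
  obtains s where "s > 0" "ball z s \<subseteq> \<Omega>" "\<And>w. w \<in> ball z s \<Longrightarrow> ball w (2 * s) \<subseteq> \<Omega>"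
proof -
  obtain R where R: "R > 0" "ball z R \<subseteq> \<Omega>" using assms open_contains_ball by blast
  show ?thesis
  proof (rule that[of "R / 4"])
    show "ball w (2 * (R / 4)) \<subseteq> \<Omega>" if "w \<in> ball z (R / 4)" for w
    proof
      fix x assume "x \<in> ball w (2 * (R / 4))"
      with that have "dist z x < R" using dist_triangle[of z x w] R(1) by simp
      then show "x \<in> \<Omega>" using R(2) by auto
    qed
  qed (use R in auto)
qed

lemma continuous_on_cgrad:
  assumes u: "real_pluriharmonic_on \<Omega> u" and "open \<Omega>"
  shows "continuous_on \<Omega> (\<lambda>z. cgrad u z m)"
proof (rule continuous_at_imp_continuous_on, rule ballI)
  fix z0 assume "z0 \<in> \<Omega>"
  then obtain s where s: "s > 0" "\<And>w. w \<in> ball z0 s \<Longrightarrow> ball w (2 * s) \<subseteq> \<Omega>"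
    using open_uniform_ball[OF assms(2)] by metis
  have contu: "continuous_on \<Omega> u" using u by (simp add: real_pluriharmonic_on_def)
  have "continuous_on (ball z0 s) (\<lambda>z. 2 / s * integral (cbox 0 1)
           (\<lambda>t. u (z + (s * cis (2 * pi * t)) *s axis m 1) * cnj (cis (2 * pi * t))))"
  proof (intro continuous_intros integral_continuous_on_param)
    have in_Om: "z + (s * cis (2 * pi * t)) *s axis m 1 \<in> \<Omega>" if "z \<in> ball z0 s" for z t
      using s(2)[OF that] s(1) by (auto simp: subset_iff dist_norm norm_mult norm_vector_smult)
    have "continuous_on (ball z0 s \<times> cbox 0 (1::real)) (\<lambda>(z, t). u (z + (s * cis (2 * pi * t)) *s axis m 1))"
      unfolding case_prod_unfold vector_scalar_mult_def cis_conv_exp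
      using in_Om
      by (intro continuous_on_compose2[OF contu] continuous_intros) (auto simp: vector_scalar_mult_def cis_conv_exp)
    then show "continuous_on (ball z0 s \<times> cbox 0 (1::real)) (\<lambda>(z, t). u (z + (s * cis (2 * pi * t)) *s axis m 1) * cnj (cis (2 * pi * t)))"
      unfolding case_prod_unfold cis_conv_exp by (intro continuous_intros)
  qed
  then have "continuous_on (ball z0 s) (\<lambda>z. cgrad u z m)"
  proof (rule continuous_on_eq)
    fix z assume "z \<in> ball z0 s"
    then show "2 / s * integral (cbox 0 1) (\<lambda>t. u (z + (s * cis (2 * pi * t)) *s axis m 1) * cnj (cis (2 * pi * t)))
        = cgrad u z m"
      by (intro cgrad_circle_average(2)[OF u s(2), symmetric]) (use s(1) in auto)
  qed
  then show "isCont (\<lambda>z. cgrad u z m) z0" using s(1) by (simp add: continuous_on_eq_continuous_at)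
qed

section \<open>Differentiability of pluriharmonic functions and of their gradient\<close>

text \<open>
  The classical argument for continuous partial derivatives: the increment is changed one complex
  coordinate at a time, and the mean value inequality controls each change. The induction runs over
  the set of coordinates already switched on.
\<close>
lemma has_derivative_of_continuous_complex_partials:
  fixes u :: "complex ^ 'n \<Rightarrow> real"
  assumes "open \<Omega>" "z \<in> \<Omega>"
    and part: "\<And>w m. w \<in> \<Omega> \<Longrightarrow> ((\<lambda>\<zeta>. u (w + \<zeta> *s axis m 1)) has_derivative (\<lambda>h. Re (g w m * h))) (at 0)"
    and cont: "\<And>m. continuous_on \<Omega> (\<lambda>w. g w m)"
  shows "(u has_derivative (\<lambda>h. Re (\<Sum>m\<in>UNIV. g z m * h $ m))) (at z)"
  unfolding has_derivative_within_alt
proof (intro conjI allI impI)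
  show "bounded_linear (\<lambda>h. Re (\<Sum>m\<in>UNIV. g z m * h $ m))"
    by (intro bounded_linear_compose[OF bounded_linear_Re] bounded_linear_sum bounded_linear_mult_right[THEN bounded_linear_compose] bounded_linear_vec_nth)
  fix e :: real assume e: "e > 0"
  define \<epsilon> where "\<epsilon> = e / CARD('n)"
  have \<epsilon>: "\<epsilon> > 0" using e by (simp add: \<epsilon>_def)
  have "\<forall>\<^sub>F w in nhds z. dist (g w m) (g z m) < \<epsilon>" for m
    using cont[of m] assms(1,2) \<epsilon>
    by (simp add: continuous_on_eq_continuous_at isCont_def tendsto_iff eventually_at_filter)
      (smt (verit) dist_self eventually_mono)
  then have "\<forall>\<^sub>F w in nhds z. w \<in> \<Omega> \<and> (\<forall>m. dist (g w m) (g z m) < \<epsilon>)"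
    using eventually_nhds_in_open[OF assms(1,2)] by (intro eventually_conj eventually_all_finite)
  then obtain d where d: "d > 0" "\<And>w. dist w z < d \<Longrightarrow> w \<in> \<Omega> \<and> (\<forall>m. dist (g w m) (g z m) < \<epsilon>)"
    unfolding eventually_nhds_metric by blast
  show "\<exists>d>0. \<forall>y\<in>UNIV. norm (y - z) < d \<longrightarrow> norm (u y - u z - Re (\<Sum>m\<in>UNIV. g z m * (y - z) $ m)) \<le> e * norm (y - z)"
  proof (intro exI[of _ d] conjI d(1) ballI impI)
    fix y assume y: "norm (y - z) < d"
    define h where "h = y - z"
    define P where "P = (\<lambda>S. \<chi> m. if m \<in> S then h $ m else 0)"
    have "\<bar>u (z + P S) - u z - Re (\<Sum>m\<in>S. g z m * h $ m)\<bar> \<le> card S * (\<epsilon> * norm h)" if "finite S" for S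
      using that
    proof (induction S)
      case empty
      have "P {} = 0" by (simp add: P_def vec_eq_iff)
      then show ?case by simp
    next
      case (insert m S)
      have Pm: "P (insert m S) = P S + (h $ m) *s axis m 1"
        using insert(2) by (auto simp: P_def vec_eq_iff axis_def)
      define k where "k = (\<lambda>\<zeta>. u (z + P S + \<zeta> *s axis m 1) - Re (g z m * \<zeta>))"
      have near: "dist (z + P S + \<zeta> *s axis m 1) z < d" if "\<zeta> \<in> cball 0 (norm (h $ m))" for \<zeta> :: complex
      proof -
        have "norm (P S + \<zeta> *s axis m 1) \<le> norm h"
          using that insert(2) by (intro norm_le_componentwise_cart) (auto simp: P_def axis_def)
        then show ?thesis using y by (simp add: dist_norm h_def add.assoc)
      qed
      have "norm (k (h $ m) - k 0) \<le> \<epsilon> * norm (h $ m - 0)"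
      proof (rule differentiable_bound)
        fix \<zeta> :: complex assume z: "\<zeta> \<in> cball 0 (norm (h $ m))"
        define w where "w = z + P S + \<zeta> *s axis m 1"
        have w: "w \<in> \<Omega>" "dist (g w m) (g z m) < \<epsilon>" using d(2)[OF near[OF z]] by (auto simp: w_def)
        have "((\<lambda>\<xi>. \<xi> - \<zeta>) has_derivative (\<lambda>h. h)) (at \<zeta>)" by (auto intro!: derivative_eq_intros)
        from has_derivative_compose[OF this, of "\<lambda>\<zeta>. u (w + \<zeta> *s axis m 1)" "\<lambda>h. Re (g w m * h)"] part[OF w(1)]
        have "((\<lambda>\<xi>. u (w + (\<xi> - \<zeta>) *s axis m 1)) has_derivative (\<lambda>h. Re (g w m * h))) (at \<zeta>)"
          by simp
        also have "(\<lambda>\<xi>. u (w + (\<xi> - \<zeta>) *s axis m 1)) = (\<lambda>\<xi>. u (z + P S + \<xi> *s axis m 1))"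
          by (simp add: w_def vector_ssub_ldistrib vector_sadd_rdistrib algebra_simps fun_eq_iff vec_eq_iff)
        finally have "(k has_derivative (\<lambda>h. Re (g w m * h) - Re (g z m * h))) (at \<zeta>)"
          unfolding k_def by (intro derivative_intros)
        then show "(k has_derivative (\<lambda>h. Re ((g (z + P S + \<zeta> *s axis m 1) m - g z m) * h))) (at \<zeta> within cball 0 (norm (h $ m)))"
          by (simp add: w_def left_diff_distrib has_derivative_at_withinI)
        show "onorm (\<lambda>h. Re ((g (z + P S + \<zeta> *s axis m 1) m - g z m) * h)) \<le> \<epsilon>"
        proof (rule onorm_le)
          fix x
          have "norm (Re ((g w m - g z m) * x)) \<le> norm (g w m - g z m) * norm x"
            by (metis abs_Re_le_cmod norm_mult real_norm_def)
          also have "\<dots> \<le> \<epsilon> * norm x" using w(2) by (intro mult_right_mono) (auto simp: dist_norm)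
          finally show "norm (Re ((g (z + P S + \<zeta> *s axis m 1) m - g z m) * x)) \<le> \<epsilon> * norm x"
            by (simp add: w_def)
        qed
      qed auto
      also have "\<dots> \<le> \<epsilon> * norm h" using \<epsilon> by (simp add: Finite_Cartesian_Product.norm_nth_le)
      finally have "\<bar>u (z + P (insert m S)) - u (z + P S) - Re (g z m * h $ m)\<bar> \<le> \<epsilon> * norm h"
        by (simp add: k_def Pm add.assoc)
      then have "\<bar>u (z + P (insert m S)) - u z - Re (\<Sum>m\<in>insert m S. g z m * h $ m)\<bar> \<le> card S * (\<epsilon> * norm h) + \<epsilon> * norm h"
        unfolding sum.insert[OF insert(1,2)] plus_complex.sel using insert.IH by linarith
      then show ?case using insert by (simp add: distrib_right)
    qed
    from this[of UNIV] have "\<bar>u (z + P UNIV) - u z - Re (\<Sum>m\<in>UNIV. g z m * h $ m)\<bar> \<le> e * norm h"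
      by (simp add: \<epsilon>_def)
    moreover have "z + P UNIV = y" by (simp add: P_def h_def vec_eq_iff)
    ultimately show "norm (u y - u z - Re (\<Sum>m\<in>UNIV. g z m * (y - z) $ m)) \<le> e * norm (y - z)"
      by (simp add: h_def)
  qed
qed

lemma real_pluriharmonic_has_derivative:
  assumes u: "real_pluriharmonic_on \<Omega> u" and "open \<Omega>" "z \<in> \<Omega>"
  shows "(u has_derivative (\<lambda>h. Re (\<Sum>m\<in>UNIV. cgrad u z m * h $ m))) (at z)"
proof (rule has_derivative_of_continuous_complex_partials[OF assms(2,3)])
  fix w m assume "w \<in> \<Omega>"
  then obtain \<rho> where "\<rho> > 0" "ball w \<rho> \<subseteq> \<Omega>" using assms(2) open_contains_ball by blast
  then show "((\<lambda>\<zeta>. u (w + \<zeta> *s axis m 1)) has_derivative (\<lambda>h. Re (cgrad u w m * h))) (at 0)"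
    by (intro cgrad_circle_average(1)[OF u, where s = "\<rho> / 2"]) auto
qed (rule continuous_on_cgrad[OF u assms(2)])

text \<open>
  Near \<open>z0\<close> the gradient is a circle average of \<open>u\<close> with a fixed radius, and \<open>u\<close> is already
  known to be continuously differentiable, so one may differentiate under the integral.
\<close>
lemma cgrad_real_differentiable:
  fixes u :: "complex ^ 'n \<Rightarrow> real"
  assumes u: "real_pluriharmonic_on \<Omega> u" and "open \<Omega>" "z0 \<in> \<Omega>"
  shows "\<exists>A. ((\<lambda>z. cgrad u z m) has_derivative A) (at z0)"
proof -
  obtain s where s: "s > 0" "\<And>w. w \<in> ball z0 s \<Longrightarrow> ball w (2 * s) \<subseteq> \<Omega>"
    using open_uniform_ball[OF assms(2,3)] by metis
  define \<gamma> where "\<gamma> = (\<lambda>t::real. (s * cis (2 * pi * t)) *s (axis m 1 :: complex ^ 'n))"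
  define L where "L = (\<lambda>z h. Re (\<Sum>k\<in>UNIV. cgrad u z k * h $ k))"
  have contu: "continuous_on \<Omega> u" using u by (simp add: real_pluriharmonic_on_def)
  have in_Om: "z + \<gamma> t \<in> \<Omega>" if "z \<in> ball z0 s" for z t
    using s(2)[OF that] s(1) by (auto simp: subset_iff dist_norm norm_mult norm_vector_smult \<gamma>_def)
  have cont\<gamma>: "continuous_on (ball z0 s \<times> cbox 0 (1::real)) (\<lambda>x. fst x + \<gamma> (snd x))"
    unfolding \<gamma>_def vector_scalar_mult_def cis_conv_exp by (intro continuous_intros)
  define D where "D = (\<lambda>z t. Blinfun (\<lambda>h. of_real (L (z + \<gamma> t) h) * cnj (cis (2 * pi * t))))"
  have blL: "bounded_linear (\<lambda>h. of_real (L w h) * c)" for w and c :: complex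
    unfolding L_def
    by (intro bounded_linear_mult_left[THEN bounded_linear_compose] bounded_linear_of_real[THEN bounded_linear_compose]
       bounded_linear_compose[OF bounded_linear_Re] bounded_linear_sum bounded_linear_mult_right[THEN bounded_linear_compose] bounded_linear_vec_nth)
  have D: "blinfun_apply (D z t) = (\<lambda>h. of_real (L (z + \<gamma> t) h) * cnj (cis (2 * pi * t)))" for z t
    unfolding D_def by (rule bounded_linear_Blinfun_apply[OF blL])
  have "((\<lambda>z. integral (cbox 0 1) (\<lambda>t. of_real (u (z + \<gamma> t)) * cnj (cis (2 * pi * t)))) has_derivative
        integral (cbox 0 1) (D z0)) (at z0 within ball z0 s)"
  proof (rule leibniz_rule)
    fix z t assume z: "z \<in> ball z0 s"
    have "((\<lambda>z. z + \<gamma> t) has_derivative (\<lambda>h. h)) (at z)" by (auto intro!: derivative_eq_intros)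
    from has_derivative_compose[OF this real_pluriharmonic_has_derivative[OF u assms(2) in_Om[OF z]]]
    have "((\<lambda>z. u (z + \<gamma> t)) has_derivative L (z + \<gamma> t)) (at z)" by (simp add: L_def)
    then show "((\<lambda>z. of_real (u (z + \<gamma> t)) * cnj (cis (2 * pi * t))) has_derivative blinfun_apply (D z t)) (at z within ball z0 s)"
      unfolding D by (rule has_derivative_at_withinI[OF has_derivative_mult_left[OF has_derivative_of_real]])
  next
    fix z assume z: "z \<in> ball z0 s"
    have "continuous_on (cbox 0 1) (\<lambda>t. u (z + \<gamma> t))"
      by (rule continuous_on_compose2[OF contu])
        (use in_Om[OF z] in \<open>auto intro!: continuous_intros simp: \<gamma>_def vector_scalar_mult_def cis_conv_exp\<close>)
    then show "(\<lambda>t. of_real (u (z + \<gamma> t)) * cnj (cis (2 * pi * t))) integrable_on cbox 0 1"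
      unfolding cis_conv_exp by (intro integrable_continuous continuous_intros)
  next
    have c: "continuous_on (ball z0 s \<times> cbox 0 (1::real)) (\<lambda>x. cgrad u (fst x + \<gamma> (snd x)) k)" for k
      by (rule continuous_on_compose2[OF continuous_on_cgrad[OF u assms(2)] cont\<gamma>]) (use in_Om in auto)
    show "continuous_on (ball z0 s \<times> cbox 0 1) (\<lambda>(z, t). D z t)"
      unfolding case_prod_unfold
      by (rule continuous_on_blinfun_componentwise)
        (auto simp: D L_def cis_conv_exp intro!: continuous_intros c[unfolded cbox_interval])
  qed (use s in auto)
  then have "((\<lambda>z. 2 / s * integral (cbox 0 1) (\<lambda>t. of_real (u (z + \<gamma> t)) * cnj (cis (2 * pi * t)))) has_derivative
        (\<lambda>h. 2 / s * blinfun_apply (integral (cbox 0 1) (D z0)) h)) (at z0 within ball z0 s)"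
    by (rule has_derivative_mult_right)
  then have "((\<lambda>z. cgrad u z m) has_derivative (\<lambda>h. 2 / s * blinfun_apply (integral (cbox 0 1) (D z0)) h)) (at z0 within ball z0 s)"
  proof (rule has_derivative_transform[rotated 2])
    fix z assume z: "z \<in> ball z0 s"
    show "cgrad u z m = 2 / s * integral (cbox 0 1) (\<lambda>t. of_real (u (z + \<gamma> t)) * cnj (cis (2 * pi * t)))"
      unfolding \<gamma>_def by (intro cgrad_circle_average(2)[OF u s(2)[OF z]]) (use s(1) in auto)
  qed (use s(1) in auto)
  then show ?thesis using s(1) by (metis at_within_open centre_in_ball open_ball)
qed

text \<open>
  Rescaling removes the normalisation of the direction, at the cost of the uniform radius.
\<close>
lemma real_pluriharmonic_line:
  assumes u: "real_pluriharmonic_on \<Omega> u" and "open \<Omega>" "z \<in> \<Omega>"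
  shows "\<exists>\<rho>>0. \<exists>F. F holomorphic_on ball 0 \<rho> \<and>
           (\<forall>\<zeta>\<in>ball 0 \<rho>. z + \<zeta> *s \<theta> \<in> \<Omega> \<and> u (z + \<zeta> *s \<theta>) = Re (F \<zeta>))"
proof (cases "\<theta> = 0")
  case True
  then show ?thesis using assms(3) by (intro exI[of _ 1] conjI exI[of _ "\<lambda>_. of_real (u z)"]) auto
next
  case False
  obtain \<rho> where \<rho>: "\<rho> > 0" "ball z \<rho> \<subseteq> \<Omega>" using assms(2,3) open_contains_ball by blast
  define c where "c = complex_of_real (norm \<theta>)"
  define \<eta> where "\<eta> = (1 / c) *s \<theta>"
  have c: "norm c = norm \<theta>" "c \<noteq> 0" using False by (auto simp: c_def)
  have "norm \<eta> = 1" using False c by (simp add: \<eta>_def norm_vector_smult norm_divide)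
  with u \<rho> obtain F where F: "F holomorphic_on ball 0 \<rho>" "\<And>\<zeta>. \<zeta> \<in> ball 0 \<rho> \<Longrightarrow> u (z + \<zeta> *s \<eta>) = Re (F \<zeta>)"
    unfolding real_pluriharmonic_on_def by blast
  have sc: "\<zeta> *s \<theta> = (c * \<zeta>) *s \<eta>" for \<zeta> using c by (simp add: \<eta>_def vector_smult_assoc)
  have inb: "c * \<zeta> \<in> ball 0 \<rho>" if "\<zeta> \<in> ball 0 (\<rho> / norm \<theta>)" for \<zeta> :: complex
    using that False by (simp add: norm_mult c field_simps)
  show ?thesis
  proof (intro exI conjI ballI)
    show "\<rho> / norm \<theta> > 0" using \<rho> False by simp
    show "(\<lambda>\<zeta>. F (c * \<zeta>)) holomorphic_on ball 0 (\<rho> / norm \<theta>)"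
      by (rule holomorphic_on_compose_gen[OF _ F(1), unfolded o_def]) (use inb in \<open>auto intro!: holomorphic_intros\<close>)
    fix \<zeta> :: complex assume z: "\<zeta> \<in> ball 0 (\<rho> / norm \<theta>)"
    show "u (z + \<zeta> *s \<theta>) = Re (F (c * \<zeta>))" unfolding sc by (rule F(2)[OF inb[OF z]])
    have "dist z (z + (c * \<zeta>) *s \<eta>) < \<rho>"
      using inb[OF z] \<open>norm \<eta> = 1\<close> by (simp add: dist_norm norm_vector_smult)
    then show "z + \<zeta> *s \<theta> \<in> \<Omega>" unfolding sc using \<rho> by auto
  qed
qed

text \<open>
  Polarisation: the diagonal condition makes \<open>B\<close> alternating, and replacing \<open>y\<close> by
  \<open>\<i> y\<close> makes it symmetric, because the two slots scale by \<open>\<i>\<close> and \<open>- \<i>\<close>.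
\<close>
lemma sesquilinear_diagonal_zero:
  fixes B :: "complex ^ 'n \<Rightarrow> complex ^ 'n \<Rightarrow> complex"
  assumes diag: "\<And>x. B x x = 0"
    and add: "\<And>x y w. B (x + y) w = B x w + B y w" "\<And>x y w. B w (x + y) = B w x + B w y"
    and i: "\<And>x y. B (\<i> *s x) y = \<i> * B x y" "\<And>x y. B x (\<i> *s y) = - \<i> * B x y"
  shows "B x y = 0"
proof -
  have sym: "B x y + B y x = 0" for x y using diag[of "x + y"] unfolding add by (simp add: diag add.commute)
  have "B x (\<i> *s y) + B (\<i> *s y) x = 0" by (rule sym)
  then have "B y x = B x y" by (simp add: i)
  with sym[of x y] show ?thesis by simp
qed

text \<open>
  Along the line in direction \<open>\<theta>\<close> the holomorphic derivative is \<open>\<Sum>m. cgrad u _ m * \<theta>\<^sub>m\<close>. Its own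
  derivative is complex linear, which says that the antilinear parts \<open>C m\<close> of the
  differentials of the \<open>cgrad u _ m\<close> satisfy \<open>\<Sum>m. \<theta>\<^sub>m * C m \<theta> = 0\<close>. This holds for every
  \<open>\<theta>\<close>, so polarisation gives \<open>C m = 0\<close>.
\<close>
lemma cgrad_complex_differentiable:
  fixes u :: "complex ^ 'n \<Rightarrow> real"
  assumes u: "real_pluriharmonic_on \<Omega> u" and "open \<Omega>" "z \<in> \<Omega>"
  shows "\<exists>A. ((\<lambda>w. cgrad u w m) has_derivative A) (at z) \<and> (\<forall>c h. A (c *s h) = c * A h)"
proof -
  obtain A where A: "\<And>m. ((\<lambda>w. cgrad u w m) has_derivative A m) (at z)"
    using cgrad_real_differentiable[OF assms] by metis
  have lin: "linear (A m)" for m using A by (rule has_derivative_linear)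
  \<comment> \<open>Up to a factor, the antilinear part of \<open>A m\<close>.\<close>
  define C where "C = (\<lambda>m h. A m (\<i> *s h) - \<i> * A m h)"
  define B where "B = (\<lambda>x y. \<Sum>m\<in>UNIV. x $ m * C m y)"
  have diag: "B \<theta> \<theta> = 0" for \<theta>
  proof -
    obtain \<rho> F where \<rho>: "\<rho> > 0" and F: "F holomorphic_on ball 0 \<rho>"
      and eq: "\<And>\<zeta>. \<zeta> \<in> ball 0 \<rho> \<Longrightarrow> z + \<zeta> *s \<theta> \<in> \<Omega> \<and> u (z + \<zeta> *s \<theta>) = Re (F \<zeta>)"
      using real_pluriharmonic_line[OF assms, of \<theta>] by blast
    have line: "((\<lambda>\<zeta>. z + \<zeta> *s \<theta>) has_derivative (\<lambda>h. h *s \<theta>)) (at \<zeta>)" for \<zeta>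
    proof -
      have "bounded_linear (\<lambda>h. h *s \<theta>)"
        unfolding linear_conv_bounded_linear[symmetric]
        by (rule linearI) (auto simp: vec_eq_iff algebra_simps)
      then show ?thesis by (auto intro!: derivative_eq_intros bounded_linear_imp_has_derivative)
    qed
    have dF: "deriv F \<zeta> = (\<Sum>m\<in>UNIV. cgrad u (z + \<zeta> *s \<theta>) m * \<theta> $ m)" if z: "\<zeta> \<in> ball 0 \<rho>" for \<zeta>
    proof (rule Re_mult_eq_imp_eq)
      have 1: "((\<lambda>\<zeta>. u (z + \<zeta> *s \<theta>)) has_derivative (\<lambda>h. Re (deriv F \<zeta> * h))) (at \<zeta>)"
        by (rule holomorphic_imp_Re_has_derivative[OF F open_ball _ z]) (use eq in auto)
      have "z + \<zeta> *s \<theta> \<in> \<Omega>" using eq[OF z] by blast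
      from has_derivative_compose[OF line real_pluriharmonic_has_derivative[OF u assms(2) this]]
      have 2: "((\<lambda>\<zeta>. u (z + \<zeta> *s \<theta>)) has_derivative (\<lambda>h. Re (\<Sum>m\<in>UNIV. cgrad u (z + \<zeta> *s \<theta>) m * (h *s \<theta>) $ m))) (at \<zeta>)" .
      show "(\<lambda>h. Re (deriv F \<zeta> * h)) = (\<lambda>h. Re ((\<Sum>m\<in>UNIV. cgrad u (z + \<zeta> *s \<theta>) m * \<theta> $ m) * h))"
        using has_derivative_unique[OF 1 2] by (simp add: sum_distrib_left sum_distrib_right mult_ac)
    qed
    have z0: "0 \<in> ball (0::complex) \<rho>" using \<rho> by simp
    have "deriv F holomorphic_on ball 0 \<rho>" by (rule holomorphic_deriv[OF F open_ball])
    then have "(deriv F has_field_derivative deriv (deriv F) 0) (at 0)"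
      by (rule holomorphic_derivI[OF _ open_ball z0])
    then have 1: "(deriv F has_derivative (*) (deriv (deriv F) 0)) (at 0)"
      by (simp add: has_field_derivative_def)
    have A0: "((\<lambda>w. cgrad u w m) has_derivative A m) (at (z + 0 *s \<theta>))" for m using A by simp
    have "((\<lambda>\<zeta>. \<Sum>m\<in>UNIV. cgrad u (z + \<zeta> *s \<theta>) m * \<theta> $ m) has_derivative (\<lambda>h. \<Sum>m\<in>UNIV. A m (h *s \<theta>) * \<theta> $ m)) (at 0)"
      by (intro has_derivative_sum has_derivative_mult_left has_derivative_compose[OF line A0])
    then have 2: "(deriv F has_derivative (\<lambda>h. \<Sum>m\<in>UNIV. A m (h *s \<theta>) * \<theta> $ m)) (at 0)"
      by (rule has_derivative_transform_within_open[OF _ open_ball z0]) (simp add: dF)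
    have eqn: "deriv (deriv F) 0 * h = (\<Sum>m\<in>UNIV. A m (h *s \<theta>) * \<theta> $ m)" for h
      using has_derivative_unique[OF 1 2] by (rule fun_cong)
    show ?thesis
      using eqn[of 1] eqn[of \<i>]
      by (simp add: B_def C_def right_diff_distrib sum_subtractf sum_distrib_left mult_ac)
  qed
  have "B x y = 0" for x y
  proof (rule sesquilinear_diagonal_zero[OF diag])
    show "B (x + y) w = B x w + B y w" for x y w by (simp add: B_def distrib_right sum.distrib)
    show "B w (x + y) = B w x + B w y" for x y w
      by (simp add: B_def C_def linear_add[OF lin] vector_add_ldistrib algebra_simps sum.distrib sum_subtractf)
    show "B (\<i> *s x) y = \<i> * B x y" for x y by (simp add: B_def sum_distrib_left mult_ac)
    have "C m (\<i> *s y) = - \<i> * C m y" for m y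
      using linear_neg[OF lin, of m y] by (simp add: C_def vector_smult_assoc vector_sneg_minus1[symmetric] algebra_simps)
    then show "B x (\<i> *s y) = - \<i> * B x y" for x y by (simp add: B_def sum_distrib_left sum_negf mult_ac)
  qed
  from this[of "axis m 1"] have "C m h = 0" for h
    by (simp add: B_def axis_def if_distrib[of "\<lambda>x. x * _"] cong: if_cong)
  then have i: "A m (\<i> *s h) = \<i> * A m h" for h by (simp add: C_def)
  have "A m (c *s h) = c * A m h" for c h
  proof -
    have "c *s h = Re c *\<^sub>R h + Im c *\<^sub>R (\<i> *s h)"
      by (simp add: vec_eq_iff complex_eq_iff)
    also have "A m \<dots> = Re c *\<^sub>R A m h + Im c *\<^sub>R (\<i> * A m h)"
      by (simp only: linear_add[OF lin] linear_scale[OF lin] i)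
    also have "\<dots> = c * A m h" by (simp add: complex_eq_iff)
    finally show ?thesis .
  qed
  then show ?thesis using A by blast
qed

text \<open>
  Complex linearity of the differentials of the gradient is what the chain rule needs: it makes the
  gradient along \<open>\<phi>\<close> holomorphic, so that the candidate for the derivative has a primitive.
\<close>
lemma real_pluriharmonic_compose_holomorphic:
  fixes u :: "complex ^ 'n \<Rightarrow> real" and \<phi> :: "complex \<Rightarrow> complex ^ 'n"
  assumes u: "real_pluriharmonic_on \<Omega> u" and "open \<Omega>"
    and S: "open S" "convex S"
    and hol: "\<And>m. (\<lambda>\<zeta>. \<phi> \<zeta> $ m) holomorphic_on S" and im: "\<phi> ` S \<subseteq> \<Omega>"
  shows "\<exists>F. F holomorphic_on S \<and> (\<forall>\<zeta>\<in>S. u (\<phi> \<zeta>) = Re (F \<zeta>) \<and>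
    (F has_field_derivative (\<Sum>m\<in>UNIV. cgrad u (\<phi> \<zeta>) m * deriv (\<lambda>\<zeta>. \<phi> \<zeta> $ m) \<zeta>)) (at \<zeta>))"
proof -
  define d where "d = (\<lambda>\<zeta>. \<chi> m. deriv (\<lambda>\<zeta>. \<phi> \<zeta> $ m) \<zeta>)"
  have d\<phi>: "(\<phi> has_derivative (\<lambda>h. h *s d \<zeta>)) (at \<zeta>)" if z: "\<zeta> \<in> S" for \<zeta>
  proof (rule has_derivative_componentwise_within[THEN iffD2], rule ballI)
    fix i :: "complex ^ 'n" assume "i \<in> Basis"
    then obtain m b where i: "i = axis m b" by (auto simp: Basis_vec_def)
    have "((\<lambda>\<zeta>. \<phi> \<zeta> $ m) has_derivative (\<lambda>h. h * d \<zeta> $ m)) (at \<zeta>)"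
      using holomorphic_derivI[OF hol S(1) z] by (simp add: has_field_derivative_def d_def mult_commute_abs)
    from has_derivative_inner_left[OF this, of b]
    show "((\<lambda>x. \<phi> x \<bullet> i) has_derivative (\<lambda>h. (h *s d \<zeta>) \<bullet> i)) (at \<zeta>)"
      by (simp add: i inner_axis)
  qed
  have "(\<lambda>\<zeta>. cgrad u (\<phi> \<zeta>) m) holomorphic_on S" for m
    unfolding holomorphic_on_open[OF S(1)]
  proof
    fix \<zeta> assume z: "\<zeta> \<in> S"
    then have "\<phi> \<zeta> \<in> \<Omega>" using im by blast
    from cgrad_complex_differentiable[OF u assms(2) this, of m] obtain A where
      A: "((\<lambda>w. cgrad u w m) has_derivative A) (at (\<phi> \<zeta>))" "\<And>c h. A (c *s h) = c * A h" by blast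
    from has_derivative_compose[OF d\<phi>[OF z] A(1)]
    show "\<exists>f'. ((\<lambda>\<zeta>. cgrad u (\<phi> \<zeta>) m) has_field_derivative f') (at \<zeta>)"
      unfolding A(2) has_field_derivative_def by (auto simp: mult_commute_abs)
  qed
  then have "(\<lambda>\<zeta>. \<Sum>m\<in>UNIV. cgrad u (\<phi> \<zeta>) m * deriv (\<lambda>\<zeta>. \<phi> \<zeta> $ m) \<zeta>) holomorphic_on S"
    by (intro holomorphic_intros holomorphic_deriv hol S(1))
  moreover have "((\<lambda>\<zeta>. u (\<phi> \<zeta>)) has_derivative (\<lambda>h. Re ((\<Sum>m\<in>UNIV. cgrad u (\<phi> \<zeta>) m * deriv (\<lambda>\<zeta>. \<phi> \<zeta> $ m) \<zeta>) * h))) (at \<zeta>)"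
    if z: "\<zeta> \<in> S" for \<zeta>
  proof -
    have "\<phi> \<zeta> \<in> \<Omega>" using im z by blast
    from has_derivative_compose[OF d\<phi>[OF z] real_pluriharmonic_has_derivative[OF u assms(2) this]]
    show ?thesis by (simp add: d_def sum_distrib_left sum_distrib_right mult_ac)
  qed
  ultimately show ?thesis by (intro has_derivative_Re_imp_eq[OF S(2,1)])
qed

section \<open>The Schwarz lemma for harmonic functions into an interval\<close>

text \<open>
  With \<open>x = \<bar>Re w\<bar>\<close> one has \<open>\<bar>tan w\<bar>\<^sup>2 = (sin\<^sup>2 x + s) / (cos\<^sup>2 x + s)\<close> for
  \<open>s = sinh\<^sup>2 (Im w) \<ge> 0\<close>, and adding \<open>s\<close> to both parts moves the fraction \<open>tan\<^sup>2 x < 1\<close> up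
  towards \<open>1\<close>.
\<close>
lemma tan_abs_Re_le_cmod_tan:
  assumes "\<bar>Re w\<bar> < pi / 4"
  shows "cos w \<noteq> 0" "tan \<bar>Re w\<bar> \<le> cmod (tan w)" "cmod (tan w) < 1"
proof -
  define x where "x = \<bar>Re w\<bar>"
  define s where "s = (exp (Im w) - inverse (exp (Im w)))\<^sup>2 / 4"
  have x: "0 \<le> x" "x < pi / 4" using assms by (auto simp: x_def)
  have c: "cos x > 0" using x by (intro cos_gt_zero_pi) auto
  have t0: "0 \<le> tan x" using x by (intro tan_pos_pi2_le) auto
  have t1: "tan x < 1" using x tan_monotone[of x "pi / 4"] by (simp add: tan_45)
  have s: "s \<ge> 0" by (simp add: s_def)
  have tc: "(tan x)\<^sup>2 * (cos x)\<^sup>2 = (sin x)\<^sup>2" using c by (simp add: tan_def power_divide)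
  have cw: "(cmod (cos w))\<^sup>2 = (cos x)\<^sup>2 + s"
    by (simp add: norm_cos_squared s_def x_def abs_if)
  have "exp (2 * Im w) + inverse (exp (2 * Im w)) = 4 * s + 2"
  proof -
    have "E * E + inverse (E * E) = 4 * ((E - inverse E)\<^sup>2 / 4) + 2" if "E \<noteq> 0" for E :: real
      using that by (simp add: power2_eq_square field_simps)
    then show ?thesis by (simp add: s_def exp_double power2_eq_square)
  qed
  moreover have "cos (2 * Re w) = 1 - 2 * (sin x)\<^sup>2"
    by (simp add: cos_double_sin x_def abs_if)
  ultimately have sw: "(cmod (sin w))\<^sup>2 = (tan x)\<^sup>2 * (cos x)\<^sup>2 + s"
    by (simp add: norm_sin_squared tc)
  have tw: "tan w = sin w / cos w" by (simp add: tan_def)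
  have tx: "(tan x)\<^sup>2 < 1" using t0 t1 by (simp add: power_less_one_iff)
  have "(cmod (cos w))\<^sup>2 > 0" unfolding cw using c s by (intro add_pos_nonneg) auto
  then show cne: "cos w \<noteq> 0" by auto
  have "(cmod (tan w))\<^sup>2 < 1"
  proof -
    have "(tan x)\<^sup>2 * (cos x)\<^sup>2 + s < (cos x)\<^sup>2 + s"
      using tx c by simp
    then show ?thesis unfolding sw[symmetric] cw[symmetric] using cne by (simp add: tw norm_divide power_divide)
  qed
  then show "cmod (tan w) < 1" by (simp add: power_less_one_iff abs_square_less_1)
  have "(tan x)\<^sup>2 \<le> (cmod (tan w))\<^sup>2"
  proof -
    have "(tan x)\<^sup>2 * ((cos x)\<^sup>2 + s) \<le> (tan x)\<^sup>2 * (cos x)\<^sup>2 + s"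
      using tx s by (simp add: distrib_left mult_left_le_one_le)
    then show ?thesis unfolding sw[symmetric] cw[symmetric] using cne
      by (simp add: tw norm_divide power_divide pos_le_divide_eq)
  qed
  then show "tan \<bar>Re w\<bar> \<le> cmod (tan w)" unfolding x_def[symmetric] by (rule power2_le_imp_le) simp
qed

text \<open>
  The Schwarz lemma for \<open>tan (\<pi>/4 \<cdot> (F - F 0))\<close>, a self-map of the disk fixing the origin.
\<close>
lemma harmonic_Schwarz:
  assumes F: "F holomorphic_on ball 0 1" and F0: "Re (F 0) = 0"
    and bd: "\<And>\<zeta>. \<zeta> \<in> ball 0 1 \<Longrightarrow> \<bar>Re (F \<zeta>)\<bar> < 1" and z: "cmod \<zeta> < 1"
  shows "\<bar>Re (F \<zeta>)\<bar> \<le> 4 / pi * arctan (cmod \<zeta>)"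
proof -
  define w where "w = (\<lambda>\<zeta>. of_real (pi / 4) * (F \<zeta> - F 0))"
  have w: "\<bar>Re (w \<xi>)\<bar> < pi / 4" if "cmod \<xi> < 1" for \<xi>
    using bd[of \<xi>] that by (simp add: w_def abs_mult F0)
  have "(\<lambda>\<zeta>. sin (w \<zeta>) / cos (w \<zeta>)) holomorphic_on ball 0 1"
    unfolding w_def using tan_abs_Re_le_cmod_tan(1)[OF w]
    by (intro holomorphic_intros F) (auto simp: w_def)
  then have hol: "(\<lambda>\<zeta>. tan (w \<zeta>)) holomorphic_on ball 0 1" by (simp add: tan_def)
  have "cmod (tan (w \<zeta>)) \<le> cmod \<zeta>"
  proof (rule Schwarz_Lemma(1)[OF hol _ _ z])
    show "cmod (tan (w \<xi>)) < 1" if "cmod \<xi> < 1" for \<xi>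
      using tan_abs_Re_le_cmod_tan(3)[OF w[OF that]] .
  qed (simp add: w_def)
  with tan_abs_Re_le_cmod_tan(2)[OF w[OF z]] have t: "tan \<bar>Re (w \<zeta>)\<bar> \<le> cmod \<zeta>" by linarith
  have "\<bar>Re (w \<zeta>)\<bar> = arctan (tan \<bar>Re (w \<zeta>)\<bar>)"
    using w[OF z] by (intro arctan_tan[symmetric]) auto
  also have "\<dots> \<le> arctan (cmod \<zeta>)" using t by (simp add: arctan_le_iff)
  finally show ?thesis by (simp add: w_def abs_mult F0 field_simps)
qed

text \<open>
  The odd part \<open>(F \<zeta> - F (- \<zeta>)) / 2\<close> has the same derivative at \<open>0\<close> as \<open>F\<close>, satisfies the
  same bound on the real part and vanishes at \<open>0\<close>, so the Schwarz lemma for harmonic functions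
  applies to it; dividing by \<open>\<bar>\<zeta>\<bar>\<close> and letting \<open>\<zeta>\<close> tend to \<open>0\<close> gives the bound.
\<close>
lemma harmonic_gradient_bound:
  assumes F: "F holomorphic_on ball 0 1"
    and bd: "\<And>\<zeta>. \<zeta> \<in> ball 0 1 \<Longrightarrow> \<bar>Re (F \<zeta>)\<bar> < 1"
    and d: "(F has_field_derivative a) (at 0)"
  shows "Re a \<le> 4 / pi"
proof -
  define G where "G = (\<lambda>\<zeta>. (F \<zeta> - F (- \<zeta>)) / 2)"
  have F': "(\<lambda>\<zeta>. F (- \<zeta>)) holomorphic_on ball 0 1"
    by (rule holomorphic_on_compose_gen[OF _ F, unfolded o_def]) (auto intro!: holomorphic_intros)
  have G: "G holomorphic_on ball 0 1" unfolding G_def by (intro holomorphic_intros F F') auto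
  have "((\<lambda>\<zeta>. F (- \<zeta>)) has_field_derivative a * (- 1)) (at 0)"
    by (rule DERIV_chain2[of F]) (auto intro!: derivative_eq_intros d)
  then have dG: "(G has_field_derivative a) (at 0)"
    unfolding G_def using d by (auto intro!: derivative_eq_intros)
  have bG: "\<bar>Re (G \<zeta>)\<bar> \<le> 4 / pi * arctan (cmod \<zeta>)" if "cmod \<zeta> < 1" for \<zeta>
  proof (rule harmonic_Schwarz[OF G _ _ that])
    fix \<xi> :: complex assume "\<xi> \<in> ball 0 1"
    then show "\<bar>Re (G \<xi>)\<bar> < 1" using bd[of \<xi>] bd[of "- \<xi>"] by (simp add: G_def abs_if split: if_splits)
  qed (simp add: G_def)
  have "((\<lambda>h. (G (0 + h) - G 0) / h) \<longlongrightarrow> a) (at 0)" using dG by (simp add: DERIV_def)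
  moreover have "filterlim complex_of_real (at 0) (at_right 0)"
    unfolding filterlim_at by (auto intro!: tendsto_eq_intros simp: eventually_at_filter)
  ultimately have "((\<lambda>t. (G (0 + of_real t) - G 0) / of_real t) \<longlongrightarrow> a) (at_right 0)"
    by (rule filterlim_compose)
  then have lim: "((\<lambda>t. Re (G (of_real t) / of_real t)) \<longlongrightarrow> Re a) (at_right 0)"
    by (intro tendsto_Re) (simp add: G_def)
  show ?thesis
  proof (rule tendsto_upperbound[OF lim])
    have "Re (G (of_real t) / of_real t) \<le> 4 / pi" if t: "0 < t" "t < 1" for t :: real
    proof -
      have "Re (G (of_real t)) \<le> 4 / pi * arctan t" using bG[of "of_real t"] t by simp
      also have "\<dots> \<le> 4 / pi * t" using t by (intro mult_left_mono arctan_le_self) auto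
      finally show ?thesis using t by (simp add: field_simps)
    qed
    then show "\<forall>\<^sub>F t in at_right 0. Re (G (of_real t) / of_real t) \<le> 4 / pi"
      unfolding eventually_at_right_field by (intro exI[of _ 1]) auto
  qed simp
qed

text \<open>
  A Moebius transformation precomposed with \<open>\<zeta> \<mapsto> c \<zeta>\<close>; the factor \<open>c\<close> adjusts the velocity at
  the origin.
\<close>
lemma disc_through_point:
  assumes z: "cmod z < 1" and c: "cmod c \<le> 1"
  defines "\<psi> \<equiv> \<lambda>\<zeta>. (z + c * \<zeta>) / (1 + cnj z * (c * \<zeta>))"
  shows "\<psi> holomorphic_on ball 0 1" "\<psi> ` ball 0 1 \<subseteq> ball 0 1" "\<psi> 0 = z"
    "deriv \<psi> 0 = c * of_real (1 - (cmod z)\<^sup>2)"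
proof -
  have eq: "\<psi> = (\<lambda>\<zeta>. Moebius_function 0 (- z) (c * \<zeta>))"
    by (simp add: \<psi>_def Moebius_function_simple add.commute)
  have inb: "cmod (c * \<zeta>) < 1" if "cmod \<zeta> < 1" for \<zeta>
    using that c mult_left_le_one_le[of "cmod \<zeta>" "cmod c"] by (simp add: norm_mult)
  have mz: "cmod (- z) < 1" using z by simp
  show "\<psi> holomorphic_on ball 0 1" unfolding eq
    by (rule holomorphic_on_compose_gen[OF _ Moebius_function_holomorphic[OF mz], unfolded o_def])
       (use inb in \<open>auto intro!: holomorphic_intros\<close>)
  show "\<psi> ` ball 0 1 \<subseteq> ball 0 1" unfolding eq using Moebius_function_norm_lt_1[OF mz inb] by auto
  show "\<psi> 0 = z" by (simp add: \<psi>_def)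
  have "(\<psi> has_field_derivative c * of_real (1 - (cmod z)\<^sup>2)) (at 0)"
    unfolding \<psi>_def of_real_diff of_real_1 complex_norm_square
    by (auto intro!: derivative_eq_intros simp: algebra_simps)
  then show "deriv \<psi> 0 = c * of_real (1 - (cmod z)\<^sup>2)" by (rule DERIV_imp_deriv)
qed

section \<open>Scalar components of pluriharmonic mappings\<close>

lemma harmonic_on_imp_differentiable:
  assumes "harmonic_on S k" "\<zeta> \<in> S"
  shows "k differentiable (at \<zeta>)"
  using assms(1) unfolding harmonic_on_def
  by (elim exE conjE) (drule bspec[OF _ assms(2)], erule differentiableI)

text \<open>
  A ball inside \<open>\<Omega>\<close> has radius at most the distance of its centre from the frontier, so the disk
  of harmonicity in the definition of pluriharmonicity covers it.
\<close>
lemma real_pluriharmonic_on_inner: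
  assumes f: "pluriharmonic_map_on \<Omega> f" and "open \<Omega>" "\<Omega> \<noteq> {}"
  shows "real_pluriharmonic_on \<Omega> (\<lambda>z. f z \<bullet> w)"
  unfolding real_pluriharmonic_on_def
proof (intro conjI allI impI)
  have ph: "pluriharmonic_on \<Omega> (\<lambda>z. f z $ j)" for j using f by (simp add: pluriharmonic_map_on_def)
  have "continuous_on \<Omega> (\<lambda>z. f z $ j)" for j using ph[of j] by (simp add: pluriharmonic_on_def)
  then show "continuous_on \<Omega> (\<lambda>z. f z \<bullet> w)"
    unfolding inner_vec_def by (intro continuous_on_sum continuous_on_inner continuous_on_const)
  fix z \<rho> and \<theta> :: "complex ^ 'a"
  assume ball: "ball z \<rho> \<subseteq> \<Omega>" and \<theta>: "norm \<theta> = 1"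
  show "\<exists>F. F holomorphic_on ball 0 \<rho> \<and> (\<forall>\<zeta>\<in>ball 0 \<rho>. f (z + \<zeta> *s \<theta>) \<bullet> w = Re (F \<zeta>))"
  proof (cases "\<rho> > 0")
    case False
    then have empty: "ball (0::complex) \<rho> = {}" by simp
    show ?thesis unfolding empty by (intro exI[of _ "\<lambda>_. 0"]) auto
  next
    case True
    then have z: "z \<in> \<Omega>" using ball by auto
    define S where "S = {\<zeta>. \<Omega> = UNIV \<or> cmod \<zeta> < infdist z (frontier \<Omega>)}"
    have S_eq: "S = UNIV \<or> S = ball 0 (infdist z (frontier \<Omega>))"
      by (auto simp: S_def)
    have S: "open S" "convex S" using S_eq by auto
    have sub: "ball 0 \<rho> \<subseteq> S"
    proof (cases "\<Omega> = UNIV")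
      case False
      then have ne: "frontier \<Omega> \<noteq> {}" using assms(3) by (simp add: frontier_eq_empty)
      have "\<rho> \<le> dist z x" if "x \<in> frontier \<Omega>" for x
      proof (rule ccontr)
        assume "\<not> \<rho> \<le> dist z x"
        then have "x \<in> \<Omega>" using ball by auto
        with that assms(2) show False by (simp add: frontier_def interior_open)
      qed
      then have "\<rho> \<le> infdist z (frontier \<Omega>)"
        unfolding infdist_def using ne by (auto intro!: cINF_greatest)
      then show ?thesis by (auto simp: S_def)
    qed (simp add: S_def)
    have "harmonic_on S (\<lambda>\<zeta>. f (z + \<zeta> *s \<theta>) $ j)" for j
      using ph[of j] z \<theta> unfolding pluriharmonic_on_def S_def by blast
    then have "\<exists>F. F holomorphic_on S \<and> (\<forall>\<zeta>\<in>S. f (z + \<zeta> *s \<theta>) $ j \<bullet> w $ j = Re (F \<zeta>))" for j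
      by (rule harmonic_on_inner_eq_Re_holomorphic[OF _ S])
    then obtain F where F: "\<And>j. F j holomorphic_on S"
      "\<And>j \<zeta>. \<zeta> \<in> S \<Longrightarrow> f (z + \<zeta> *s \<theta>) $ j \<bullet> w $ j = Re (F j \<zeta>)" by metis
    show ?thesis
    proof (intro exI conjI ballI)
      show "(\<lambda>\<zeta>. \<Sum>j\<in>UNIV. F j \<zeta>) holomorphic_on ball 0 \<rho>"
        by (intro holomorphic_intros holomorphic_on_subset[OF F(1) sub])
      show "f (z + \<zeta> *s \<theta>) \<bullet> w = Re (\<Sum>j\<in>UNIV. F j \<zeta>)" if "\<zeta> \<in> ball 0 \<rho>" for \<zeta>
        using sub that by (simp add: inner_vec_def F(2) subset_iff)
    qed
  qed
qed

lemma of_real_axis: "axis m (c :: complex) = c *s axis m 1"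
  by (simp add: vec_eq_iff axis_def)

lemma partials_of_has_derivative:
  assumes "((\<lambda>\<zeta>. v (z + \<zeta> *s axis m 1)) has_derivative D) (at 0)"
  shows "partial_x m v z = D 1" "partial_y m v z = D \<i>"
proof -
  have lin: "linear D" using assms by (rule has_derivative_linear)
  have "((\<lambda>t. v (z + axis m (c * of_real t))) has_vector_derivative D c) (at 0)" for c
  proof -
    have "((\<lambda>t. c * of_real t) has_derivative (\<lambda>t. c * of_real t)) (at 0)"
      by (auto intro!: derivative_eq_intros)
    from has_derivative_compose[OF this, of "\<lambda>\<zeta>. v (z + \<zeta> *s axis m 1)" D] assms
    have "((\<lambda>t. v (z + (c * of_real t) *s axis m 1)) has_derivative (\<lambda>t. D (c * of_real t))) (at 0)" by simp
    moreover have "D (c * of_real t) = t *\<^sub>R D c" for t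
      using linear_scale[OF lin, of t c] by (simp add: scaleR_conv_of_real mult.commute)
    ultimately show ?thesis by (simp add: has_vector_derivative_def of_real_axis[symmetric])
  qed
  from this[of 1] this[of \<i>] show "partial_x m v z = D 1" "partial_y m v z = D \<i>"
    by (auto simp: partial_x_def partial_y_def intro!: vector_derivative_at)
qed

text \<open>
  The bridge between the matrices of Wirtinger derivatives and the complex gradient: on both sides
  stands the real differential of \<open>z \<mapsto> f z \<bullet> w\<close> in direction \<open>\<theta>\<close>.
\<close>
lemma inner_differential_eq_cgrad:
  assumes f: "pluriharmonic_map_on \<Omega> f" and "open \<Omega>" "z \<in> \<Omega>"
  shows "(D_mat f z *v \<theta> + Dbar_mat f z *v cnj_vec \<theta>) \<bullet> w
       = Re (\<Sum>m\<in>UNIV. cgrad (\<lambda>z. f z \<bullet> w) z m * \<theta> $ m)"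
proof -
  define D where "D = (\<lambda>j m. frechet_derivative (\<lambda>\<zeta>. f (z + \<zeta> *s axis m 1) $ j) (at 0))"
  have D: "((\<lambda>\<zeta>. f (z + \<zeta> *s axis m 1) $ j) has_derivative D j m) (at 0)" for j m
  proof -
    have "harmonic_on {\<zeta>. \<Omega> = UNIV \<or> cmod \<zeta> < infdist z (frontier \<Omega>)} (\<lambda>\<zeta>. f (z + \<zeta> *s axis m 1) $ j)"
      using f assms(3) unfolding pluriharmonic_map_on_def pluriharmonic_on_def by simp
    moreover have "\<Omega> = UNIV \<or> 0 < infdist z (frontier \<Omega>)"
    proof -
      have "z \<notin> frontier \<Omega>" using assms(2,3) by (simp add: frontier_def interior_open)
      then show ?thesis using assms(3) frontier_eq_empty[of \<Omega>]
        using in_closed_iff_infdist_zero[of "frontier \<Omega>" z] infdist_nonneg[of z "frontier \<Omega>"]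
        by (auto simp: less_le)
    qed
    then have "0 \<in> {\<zeta>. \<Omega> = UNIV \<or> cmod \<zeta> < infdist z (frontier \<Omega>)}" by simp
    ultimately show ?thesis
      unfolding D_def by (intro frechet_derivative_works[THEN iffD1] harmonic_on_imp_differentiable)
  qed
  have lin: "linear (D j m)" for j m using D by (rule has_derivative_linear)
  have D_eq: "D j m c = Re c *\<^sub>R D j m 1 + Im c *\<^sub>R D j m \<i>" for j m c
  proof -
    have "c = Re c *\<^sub>R 1 + Im c *\<^sub>R \<i>" by (simp add: complex_eq_iff)
    then have "D j m c = D j m (Re c *\<^sub>R 1 + Im c *\<^sub>R \<i>)" by simp
    then show ?thesis by (simp only: linear_add[OF lin] linear_scale[OF lin])
  qed
  have L: "(D_mat f z *v \<theta> + Dbar_mat f z *v cnj_vec \<theta>) $ j = (\<Sum>m\<in>UNIV. D j m (\<theta> $ m))" for j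
  proof -
    have "wirtinger m (\<lambda>w. f w $ j) z * \<theta> $ m + wirtinger_bar m (\<lambda>w. f w $ j) z * cnj (\<theta> $ m) = D j m (\<theta> $ m)" for m
      unfolding wirtinger_def wirtinger_bar_def partials_of_has_derivative[OF D] D_eq[of j m "\<theta> $ m"]
      by (simp add: complex_eq_iff field_simps)
    then show ?thesis
      by (simp add: matrix_vector_mult_def D_mat_def Dbar_mat_def cnj_vec_def sum.distrib[symmetric])
  qed
  have rp: "real_pluriharmonic_on \<Omega> (\<lambda>z. f z \<bullet> w)"
    by (rule real_pluriharmonic_on_inner[OF f assms(2)]) (use assms(3) in auto)
  obtain \<rho> where \<rho>: "\<rho> > 0" "ball z \<rho> \<subseteq> \<Omega>" using assms(2,3) open_contains_ball by blast
  have C: "(\<Sum>j\<in>UNIV. D j m h \<bullet> w $ j) = Re (cgrad (\<lambda>z. f z \<bullet> w) z m * h)" for m h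
  proof -
    have "((\<lambda>\<zeta>. f (z + \<zeta> *s axis m 1) \<bullet> w) has_derivative (\<lambda>h. \<Sum>j\<in>UNIV. D j m h \<bullet> w $ j)) (at 0)"
      unfolding inner_vec_def by (intro has_derivative_sum has_derivative_inner_left D)
    moreover have "((\<lambda>\<zeta>. f (z + \<zeta> *s axis m 1) \<bullet> w) has_derivative (\<lambda>h. Re (cgrad (\<lambda>z. f z \<bullet> w) z m * h))) (at 0)"
      by (rule cgrad_circle_average(1)[OF rp \<rho>(2), of "\<rho> / 2"]) (use \<rho> in auto)
    ultimately show ?thesis by (rule has_derivative_unique[THEN fun_cong])
  qed
  have "(D_mat f z *v \<theta> + Dbar_mat f z *v cnj_vec \<theta>) \<bullet> w = (\<Sum>j\<in>UNIV. \<Sum>m\<in>UNIV. D j m (\<theta> $ m) \<bullet> w $ j)"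
    unfolding inner_vec_def L inner_sum_left ..
  also have "\<dots> = (\<Sum>m\<in>UNIV. Re (cgrad (\<lambda>z. f z \<bullet> w) z m * \<theta> $ m))"
    by (subst sum.swap) (simp only: C)
  finally show ?thesis by simp
qed

section \<open>The sup norm and the polydisk\<close>

lemma cmod_le_sup_norm: "cmod (z $ j) \<le> sup_norm z"
  unfolding sup_norm_def by (rule Max_ge) auto

lemma sup_norm_attained: obtains j where "sup_norm z = cmod (z $ j)"
proof -
  have "sup_norm z \<in> range (\<lambda>j. cmod (z $ j))" unfolding sup_norm_def by (rule Max_in) auto
  then show ?thesis using that by auto
qed

lemma sup_norm_lt_1: "z \<in> polydisk \<Longrightarrow> sup_norm z < 1"
  by (rule sup_norm_attained[of z]) (auto simp: polydisk_def)

lemma sup_norm_nonneg: "0 \<le> sup_norm z"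
  by (rule sup_norm_attained[of z]) auto

lemma open_polydisk: "open (polydisk :: (complex ^ 'n) set)"
proof -
  have eq: "polydisk = (\<Inter>j. {z :: complex ^ 'n. cmod (z $ j) < 1})" by (auto simp: polydisk_def)
  show ?thesis unfolding eq
    by (auto intro!: open_INT open_Collect_less continuous_intros)
qed

lemma compact_sup_norm_sphere: "compact {\<theta> :: complex ^ 'n. sup_norm \<theta> = 1}"
proof -
  have eq: "{\<theta> :: complex ^ 'n. sup_norm \<theta> = 1} = (\<Inter>j. {\<theta>. cmod (\<theta> $ j) \<le> 1}) \<inter> (\<Union>j. {\<theta>. cmod (\<theta> $ j) = 1})"
  proof (intro set_eqI iffI)
    fix \<theta> :: "complex ^ 'n" assume a: "\<theta> \<in> {\<theta>. sup_norm \<theta> = 1}"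
    obtain j where "sup_norm \<theta> = cmod (\<theta> $ j)" by (rule sup_norm_attained)
    with a show "\<theta> \<in> (\<Inter>j. {\<theta>. cmod (\<theta> $ j) \<le> 1}) \<inter> (\<Union>j. {\<theta>. cmod (\<theta> $ j) = 1})"
      using cmod_le_sup_norm[of \<theta>] by auto
  next
    fix \<theta> :: "complex ^ 'n" assume a: "\<theta> \<in> (\<Inter>j. {\<theta>. cmod (\<theta> $ j) \<le> 1}) \<inter> (\<Union>j. {\<theta>. cmod (\<theta> $ j) = 1})"
    then obtain j where "cmod (\<theta> $ j) = 1" by auto
    then have "sup_norm \<theta> \<ge> 1" using cmod_le_sup_norm[of \<theta> j] by simp
    moreover have "sup_norm \<theta> \<le> 1" using a by (auto intro: sup_norm_attained[of \<theta>])
    ultimately show "\<theta> \<in> {\<theta>. sup_norm \<theta> = 1}" by simp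
  qed
  have "closed {\<theta> :: complex ^ 'n. sup_norm \<theta> = 1}" unfolding eq
    by (intro closed_Int closed_INT closed_UN ballI closed_Collect_le closed_Collect_eq continuous_intros) auto
  moreover have "norm \<theta> \<le> CARD('n)" if "sup_norm \<theta> = 1" for \<theta> :: "complex ^ 'n"
  proof -
    have "norm \<theta> \<le> (\<Sum>j\<in>UNIV. cmod (\<theta> $ j))" unfolding norm_vec_def by (rule L2_set_le_sum) simp
    also have "\<dots> \<le> (\<Sum>j\<in>(UNIV :: 'n set). 1)" using cmod_le_sup_norm[of \<theta>] that by (intro sum_mono) simp
    finally show ?thesis by simp
  qed
  then have "bounded {\<theta> :: complex ^ 'n. sup_norm \<theta> = 1}" unfolding bounded_iff by blast
  ultimately show ?thesis by (simp add: compact_eq_bounded_closed)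
qed

section \<open>The estimates on the polydisk\<close>

lemma inner_sgn_self: "x \<bullet> sgn x = norm (x :: 'a :: real_inner)"
  by (cases "x = 0") (simp_all add: sgn_div_norm dot_square_norm power2_eq_square)

lemma abs_inner_sgn_less_1:
  fixes x y :: "'a :: real_inner"
  assumes "norm x < 1"
  shows "\<bar>x \<bullet> sgn y\<bar> < 1"
proof -
  have "\<bar>x \<bullet> sgn y\<bar> \<le> norm x * norm (sgn y)" by (rule Cauchy_Schwarz_ineq2)
  also have "\<dots> \<le> norm x" by (simp add: norm_sgn)
  finally show ?thesis using assms by simp
qed

text \<open>
  The disk \<open>\<phi>\<close> runs through \<open>z\<close> with velocity \<open>(1 - \<parallel>z\<parallel>\<^sup>2) \<theta>\<close>; the scalar gradient bound for
  \<open>u \<circ> \<phi>\<close> then carries exactly the factor of the claim.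
\<close>
lemma polydisk_gradient_bound:
  fixes f :: "complex ^ 'n \<Rightarrow> complex ^ 'N"
  assumes f: "pluriharmonic_map_on polydisk f" "f ` polydisk \<subseteq> ball 0 1"
    and z: "z \<in> polydisk" and \<theta>: "sup_norm \<theta> \<le> 1"
  shows "norm (D_mat f z *v \<theta> + Dbar_mat f z *v cnj_vec \<theta>) \<le> 4 / (pi * (1 - (sup_norm z)\<^sup>2))"
proof -
  define R where "R = 1 - (sup_norm z)\<^sup>2"
  have R: "R > 0" using sup_norm_lt_1[OF z] sup_norm_nonneg[of z] by (simp add: R_def power_less_one_iff abs_square_less_1)
  define L where "L = D_mat f z *v \<theta> + Dbar_mat f z *v cnj_vec \<theta>"
  \<comment> \<open>A unit vector, or zero if \<open>L\<close> is; in both cases \<open>L \<bullet> w\<close> is the norm of \<open>L\<close>.\<close>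
  define w where "w = sgn L"
  define u where "u = (\<lambda>x. f x \<bullet> w)"
  have u: "real_pluriharmonic_on polydisk u"
    unfolding u_def using z by (intro real_pluriharmonic_on_inner[OF f(1) open_polydisk]) auto
  \<comment> \<open>The velocity \<open>c j (1 - \<bar>z\<^sub>j\<bar>\<^sup>2)\<close> of the \<open>j\<close>-th coordinate disk at the origin is to be \<open>R \<theta>\<^sub>j\<close>.\<close>
  define c where "c = (\<lambda>j. \<theta> $ j * of_real (R / (1 - (cmod (z $ j))\<^sup>2)))"
  have zj: "cmod (z $ j) < 1" for j using z by (simp add: polydisk_def)
  have den: "R \<le> 1 - (cmod (z $ j))\<^sup>2" for j
    using cmod_le_sup_norm[of z j] by (simp add: R_def power_mono)
  have c: "cmod (c j) \<le> 1" for j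
  proof -
    have "\<bar>R / (1 - (cmod (z $ j))\<^sup>2)\<bar> \<le> 1" using den[of j] R by (simp add: abs_divide)
    moreover have "cmod (\<theta> $ j) \<le> 1" using cmod_le_sup_norm[of \<theta> j] \<theta> by simp
    ultimately show ?thesis unfolding c_def norm_mult norm_of_real by (intro mult_le_one) auto
  qed
  define \<phi> where "\<phi> = (\<lambda>\<zeta>. \<chi> j. (z $ j + c j * \<zeta>) / (1 + cnj (z $ j) * (c j * \<zeta>)))"
  note \<psi> = disc_through_point[OF zj c]
  have im: "\<phi> ` ball 0 1 \<subseteq> polydisk"
    using \<psi>(2) by (auto simp: \<phi>_def polydisk_def image_subset_iff)
  have \<phi>0: "\<phi> 0 = z" by (simp add: \<phi>_def vec_eq_iff)
  have d\<phi>: "deriv (\<lambda>\<zeta>. \<phi> \<zeta> $ j) 0 = of_real R * \<theta> $ j" for j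
  proof -
    have "1 - (cmod (z $ j))\<^sup>2 \<noteq> 0" using den[of j] R by linarith
    then show ?thesis using \<psi>(4)[of j] by (simp add: \<phi>_def c_def del: of_real_diff)
  qed
  have "\<exists>F. F holomorphic_on ball 0 1 \<and> (\<forall>\<zeta>\<in>ball 0 1. u (\<phi> \<zeta>) = Re (F \<zeta>) \<and>
    (F has_field_derivative (\<Sum>m\<in>UNIV. cgrad u (\<phi> \<zeta>) m * deriv (\<lambda>\<zeta>. \<phi> \<zeta> $ m) \<zeta>)) (at \<zeta>))"
    by (rule real_pluriharmonic_compose_holomorphic[OF u open_polydisk open_ball convex_ball _ im])
      (use \<psi>(1) in \<open>simp add: \<phi>_def\<close>)
  then obtain F where F: "F holomorphic_on ball 0 1" "\<And>\<zeta>. \<zeta> \<in> ball 0 1 \<Longrightarrow> u (\<phi> \<zeta>) = Re (F \<zeta>)"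
    and dF: "\<And>\<zeta>. \<zeta> \<in> ball 0 1 \<Longrightarrow>
      (F has_field_derivative (\<Sum>m\<in>UNIV. cgrad u (\<phi> \<zeta>) m * deriv (\<lambda>\<zeta>. \<phi> \<zeta> $ m) \<zeta>)) (at \<zeta>)" by blast
  have dF0: "(F has_field_derivative (\<Sum>m\<in>UNIV. cgrad u z m * (of_real R * \<theta> $ m))) (at 0)"
    using dF[of 0] unfolding \<phi>0 d\<phi> by simp
  have "\<bar>Re (F \<zeta>)\<bar> < 1" if "\<zeta> \<in> ball 0 1" for \<zeta>
  proof -
    have "norm (f (\<phi> \<zeta>)) < 1" using im f(2) that by (auto simp: image_subset_iff)
    from abs_inner_sgn_less_1[OF this, of L] show ?thesis
      using F(2)[OF that] by (simp add: u_def w_def)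
  qed
  from harmonic_gradient_bound[OF F(1) this dF0]
  have "R * Re (\<Sum>m\<in>UNIV. cgrad u z m * \<theta> $ m) \<le> 4 / pi"
    by (simp add: sum_distrib_left algebra_simps sum_subtractf)
  also have "Re (\<Sum>m\<in>UNIV. cgrad u z m * \<theta> $ m) = L \<bullet> w"
    unfolding L_def u_def by (rule inner_differential_eq_cgrad[OF f(1) open_polydisk z, symmetric])
  also have "L \<bullet> w = norm L" by (simp add: w_def inner_sgn_self)
  finally show ?thesis using R unfolding L_def[symmetric] R_def[symmetric] by (simp add: field_simps)
qed

lemma polydisk_Schwarz:
  fixes f :: "complex ^ 'n \<Rightarrow> complex ^ 'N"
  assumes f: "pluriharmonic_map_on polydisk f" "f ` polydisk \<subseteq> ball 0 1"
    and f0: "f 0 = 0" and z: "z \<in> polydisk"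
  shows "norm (f z) \<le> 4 / pi * arctan (sup_norm z)"
proof (cases "sup_norm z = 0")
  case True
  then have "z = 0" using cmod_le_sup_norm[of z] by (simp add: vec_eq_iff)
  then show ?thesis using f0 True by simp
next
  case False
  define r where "r = sup_norm z"
  have r: "0 < r" "r < 1" using False sup_norm_nonneg[of z] sup_norm_lt_1[OF z] by (auto simp: r_def)
  define w where "w = sgn (f z)"
  define u where "u = (\<lambda>x. f x \<bullet> w)"
  have u: "real_pluriharmonic_on polydisk u"
    unfolding u_def using z by (intro real_pluriharmonic_on_inner[OF f(1) open_polydisk]) auto
  define \<phi> where "\<phi> = (\<lambda>\<zeta>. (\<zeta> / of_real r) *s z)"
  have im: "\<phi> ` ball 0 1 \<subseteq> polydisk"
  proof (rule image_subsetI)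
    fix \<zeta> :: complex assume "\<zeta> \<in> ball 0 1"
    then have "cmod \<zeta> < 1" by simp
    have "cmod (\<phi> \<zeta> $ j) < 1" for j
    proof -
      have "cmod (\<phi> \<zeta> $ j) = cmod \<zeta> * (cmod (z $ j) / r)" using r by (simp add: \<phi>_def norm_mult norm_divide)
      also have "\<dots> \<le> cmod \<zeta> * 1"
        using cmod_le_sup_norm[of z j] r by (intro mult_left_mono) (auto simp: r_def)
      finally show ?thesis using \<open>cmod \<zeta> < 1\<close> by simp
    qed
    then show "\<phi> \<zeta> \<in> polydisk" by (simp add: polydisk_def)
  qed
  have "\<exists>F. F holomorphic_on ball 0 1 \<and> (\<forall>\<zeta>\<in>ball 0 1. u (\<phi> \<zeta>) = Re (F \<zeta>) \<and>
    (F has_field_derivative (\<Sum>m\<in>UNIV. cgrad u (\<phi> \<zeta>) m * deriv (\<lambda>\<zeta>. \<phi> \<zeta> $ m) \<zeta>)) (at \<zeta>))"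
    by (rule real_pluriharmonic_compose_holomorphic[OF u open_polydisk open_ball convex_ball _ im])
      (use r in \<open>auto simp: \<phi>_def intro!: holomorphic_intros\<close>)
  then obtain F where F: "F holomorphic_on ball 0 1" "\<And>\<zeta>. \<zeta> \<in> ball 0 1 \<Longrightarrow> u (\<phi> \<zeta>) = Re (F \<zeta>)"
    by blast
  have bd: "\<bar>Re (F \<zeta>)\<bar> < 1" if "\<zeta> \<in> ball 0 1" for \<zeta>
  proof -
    have "norm (f (\<phi> \<zeta>)) < 1" using im f(2) that by (auto simp: image_subset_iff)
    from abs_inner_sgn_less_1[OF this, of "f z"] show ?thesis
      using F(2)[OF that] by (simp add: u_def w_def)
  qed
  have F0: "Re (F 0) = 0" using F(2)[of 0] by (simp add: \<phi>_def u_def f0)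
  have "\<phi> (of_real r) = z" using r by (simp add: \<phi>_def)
  then have "u z = Re (F (of_real r))" using F(2)[of "of_real r"] r by simp
  moreover have "\<bar>Re (F (of_real r))\<bar> \<le> 4 / pi * arctan (cmod (of_real r))"
    by (rule harmonic_Schwarz[OF F(1) F0 bd]) (use r in auto)
  moreover have "u z = norm (f z)" by (simp add: u_def w_def inner_sgn_self)
  ultimately show ?thesis using r by (simp add: r_def)
qed

theorem theorem2:
  fixes f :: "complex ^ 'n \<Rightarrow> complex ^ 'N"
  assumes "pluriharmonic_map_on polydisk f"
    and "f ` polydisk \<subseteq> ball 0 1"
  shows "(\<forall>z\<in>polydisk. \<exists>M.
            is_maximum_on (\<lambda>\<theta>. norm (D_mat f z *v \<theta> + Dbar_mat f z *v cnj_vec \<theta>))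
              {\<theta>. sup_norm \<theta> = 1} M \<and>
            M \<le> 4 / (pi * (1 - (sup_norm z)\<^sup>2))) \<and>
         (f 0 = 0 \<longrightarrow> (\<forall>z\<in>polydisk. norm (f z) \<le> 4 / pi * arctan (sup_norm z)))"
proof (intro conjI impI ballI)
  fix z :: "complex ^ 'n" assume z: "z \<in> polydisk"
  let ?S = "{\<theta> :: complex ^ 'n. sup_norm \<theta> = 1}"
  let ?F = "\<lambda>\<theta>. norm (D_mat f z *v \<theta> + Dbar_mat f z *v cnj_vec \<theta>)"
  have "sup_norm (\<chi> j. 1 :: complex ^ 'n) = 1" by (simp add: sup_norm_def)
  then have ne: "?S \<noteq> {}" by blast
  have "continuous_on ?S ?F"
    unfolding matrix_vector_mult_def cnj_vec_def by (intro continuous_intros)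
  then obtain \<theta> where \<theta>: "\<theta> \<in> ?S" "\<And>\<eta>. \<eta> \<in> ?S \<Longrightarrow> ?F \<eta> \<le> ?F \<theta>"
    using continuous_attains_sup[OF compact_sup_norm_sphere ne] by blast
  show "\<exists>M. is_maximum_on ?F ?S M \<and> M \<le> 4 / (pi * (1 - (sup_norm z)\<^sup>2))"
  proof (intro exI conjI)
    show "is_maximum_on ?F ?S (?F \<theta>)" using \<theta> by (auto simp: is_maximum_on_def)
    show "?F \<theta> \<le> 4 / (pi * (1 - (sup_norm z)\<^sup>2))"
      using \<theta>(1) by (intro polydisk_gradient_bound[OF assms z]) simp
  qed
next
  fix z :: "complex ^ 'n" assume "f 0 = 0" "z \<in> polydisk"
  then show "norm (f z) \<le> 4 / pi * arctan (sup_norm z)" by (rule polydisk_Schwarz[OF assms])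
qed

end
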